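(* Let $F=(f_1,\ldots,f_k):\mathbb{A}^n\to\mathbb{A}^k$, $n\ge k$, be a real, complex or mixed polynomial mapping with non-constant components, depending effectively on all the variables, such that $F(0)=0$. If $F$ is non-degenerate at infinity, then $$K_\infty(F)\subset N(F)\cup A(F).$$
   Context: **Mappings.** $F=(f_1,\ldots,f_k):\mathbb{A}^n\to\mathbb{A}^k$ is of one of three types: real ($\mathbb{A}=\mathbb{R}$, $f_j$ real polynomials), complex ($\mathbb{A}=\mathbb{C}$, $f_j$ complex polynomials in $z$), or mixed ($\mathbb{A}=\mathbb{C}$, $f_j$ polynomials in $z$ and $\bar z$ with complex coefficients). $\mathbb{A}^*=\mathbb{A}\setminus\{0\}$. For a map, $\operatorname{Sing}$ denotes the set of points where the differential is not surjective; for mixed maps this is the real differential of the underlying real map ($\mathbb{C}=\mathbb{R}^2$). $F$ *depends effectively on all the variables* if for every variable $z_i$ some $f_j$ depends effectively on $z_i$. **Asymptotic critical values.** For a $C^1$ real semi-algebraic map $F:\mathbb{A}^n\to\mathbb{A}^k$, $K_\infty(F)$ is the set of $c\in\mathbb{A}^k$ for which there is a sequence $\{x_l\}_{l\in\mathbb{N}}\subset\mathbb{A}^n$ with $\|x_l\|\to\infty$, $F(x_l)\to c$ and $(1+\|x_l\|)\,\nu(dF(x_l))\to 0$, where $\nu(B)=\inf_{\|\varphi\|=1}\|B^*(\varphi)\|$ for a linear map $B$ with adjoint $B^*$ (for mixed maps, $dF$ is the real differential of the underlying real map). **Supports and Newton polyhedra.** For $f(x)=\sum_\nu c_\nu x^\nu$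 put $\operatorname{supp}(f)=\{\nu\in\mathbb{N}^n: c_\nu\ne0\}$; for mixed $f(z,\bar z)=\sum_{\nu,\mu}c_{\nu,\mu}z^\nu\bar z^\mu$ put $\operatorname{supp}(f)=\{\nu+\mu: c_{\nu,\mu}\neq0\}$. When $f(0)=0$, $\Gamma_0(f)$ is the convex hull of $\{0\}\cup\operatorname{supp}(f)$. For a face $\Delta$ (of any dimension), $f_\Delta=\sum_{\nu\in\Delta\cap\operatorname{supp}(f)}c_\nu x^\nu$, resp. $f_\Delta=\sum_{\nu+\mu\in\Delta\cap\operatorname{supp}(f)}c_{\nu,\mu}z^\nu\bar z^\mu$ in the mixed case. **Dual subdivision.** For $\mathbf{p}=(p_1,\ldots,p_n)\in\mathbb{Z}^n$ with $\min_i p_i<0$, let $l_{\mathbf{p}}(v)=\sum_i p_iv_i$ and let $\Delta^j_{\mathbf{p}}$ be the maximal face of $\Gamma_0(f_j)$ on which $l_{\mathbf{p}}$ attains its minimum over $\Gamma_0(f_j)$. Declare $\mathbf{p}\sim\mathbf{p}'$ iff $\Delta^j_{\mathbf{p}}=\Delta^j_{\mathbf{p}'}$ for all $1\le j\le k$. The equivalence classes give a partition of $\mathbb{R}^n\setminus\mathbb{R}^n_+$ (where $\mathbb{R}_+^n$ is the set of vectors with all coordinates $\ge 0$) into finitely many locally closed cones; each is subdivided into finitely many convex polyhedral cones, and $\mathcal{C}(F)$ is the finite set of cones obtained. For $\sigma\in\mathcal{C}(F)$, write $\Delta^j_\sigma:=\Delta^j_{\mathbf{p}}$ for any $\mathbf{p}\in\sigma$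 (independent of $\mathbf{p}$), and $$I_\sigma=\{j: 0\notin\Delta^j_\sigma\},\quad J_\sigma=\{j:\Delta^j_\sigma=\{0\}\},\quad I_\sigma^c=\{1,\ldots,k\}\setminus I_\sigma,$$ $$G_\sigma=\{x\in(\mathbb{A}^* )^n: f_{\Delta^j_\sigma}(x)=0\ \text{for all } j\in I_\sigma\},$$ where $f_{\Delta^j_\sigma}$ stands for $(f_j)_{\Delta^j_\sigma}$. **Non-degeneracy at infinity.** $F$ (with $F(0)=0$) is *non-degenerate at infinity* if for every $\sigma\in\mathcal{C}(F)$ with $I_\sigma\neq\emptyset$ and $J_\sigma=\emptyset$, one has $\operatorname{Sing}\,(f_{\Delta^j_\sigma})_{j\in I_\sigma}\cap G_\sigma=\emptyset$. **The set $N(F)$.** $N(F)=\bigcup_{\sigma\in\mathcal{C}(F),\,J_\sigma\ne\emptyset}N_\sigma$, where $N_\sigma=\{(z_1,\ldots,z_k)\in\mathbb{A}^k: z_j=0\ \text{for all } j\in J_\sigma\}$. **The set $A(F)$.** $A(F)=\bigcup_\sigma A_\sigma$ over all $\sigma\in\mathcal{C}(F)$ with $J_\sigma=\emptyset$ and $I^c_\sigma\neq\emptyset$. Here $F_\sigma:=(f_{\Delta^j_\sigma})_{j\in I_\sigma^c}:G_\sigma\to\mathbb{A}^{|I^c_\sigma|}$ (with $G_\sigma=(\mathbb{A}^* )^n$ if $I_\sigma=\emptyset$), $\operatorname{Disc}F_\sigma=F_\sigma(\operatorname{Sing}F_\sigma)$ is its set of critical values, and $A_\sigma=\pi_{I_\sigma^c}^{-1}(\operatorname{Disc}F_\sigma)\subset\mathbb{A}^k$,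 where $\pi_{J}:\mathbb{A}^k\to\mathbb{A}^{|J|}$ is the projection onto the coordinates indexed by $J$. *)

theory Defs
  imports "HOL-Analysis.Analysis" "HOL-Library.Poly_Mapping"
begin

text \<open>
  The ground field \<open>\<real>\<close> or \<open>\<complex>\<close> is a type \<open>'a\<close> carrying its Euclidean structure.
  All differentials are real Frechet derivatives. For a holomorphic map the complex
  differential is the same function, with the same image, and its Hermitian adjoint is
  its adjoint for the real inner product.
\<close>

definition nu :: "('x::euclidean_space \<Rightarrow> 'y::euclidean_space) \<Rightarrow> real" where
  "nu B = (INF \<phi>\<in>sphere 0 1. norm (adjoint B \<phi>))"

definition K_infinity :: "('x::euclidean_space \<Rightarrow> 'y::euclidean_space) \<Rightarrow> 'y set" where
  "K_infinity F = {c. \<exists>X :: nat \<Rightarrow> 'x.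
      filterlim (\<lambda>l. norm (X l)) at_top sequentially \<and>
      (\<lambda>l. F (X l)) \<longlonglongrightarrow> c \<and>
      (\<lambda>l. (1 + norm (X l)) * nu (frechet_derivative F (at (X l)))) \<longlonglongrightarrow> 0}"

definition tangent_space :: "'x::real_normed_vector set \<Rightarrow> 'x \<Rightarrow> 'x set" where
  "tangent_space M x = {v. \<exists>\<gamma> \<epsilon>. \<epsilon> > 0 \<and> \<gamma> (0::real) = x \<and>
      (\<forall>t\<in>{-\<epsilon><..<\<epsilon>}. \<gamma> t \<in> M) \<and> (\<gamma> has_vector_derivative v) (at 0)}"

text \<open>
  The product \<open>\<bbbA>\<^sup>J\<close>, for a set \<open>J\<close> of indices, is realised as the coordinate subspace of
  \<open>\<bbbA>\<^sup>k\<close> on which the coordinates outside \<open>J\<close> vanish.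
\<close>

definition coord_subspace :: "'k set \<Rightarrow> ('a::zero ^ 'k::finite) set" where
  "coord_subspace J = {y. \<forall>j. j \<notin> J \<longrightarrow> y $ j = 0}"

definition coord_proj :: "'k set \<Rightarrow> 'a::zero ^ 'k::finite \<Rightarrow> 'a ^ 'k" where
  "coord_proj J y = (\<chi> j. if j \<in> J then y $ j else 0)"

text \<open>
  Singular points of the restriction to a submanifold \<open>M\<close> of a map \<open>g\<close> given on the whole
  ambient space, with values in \<open>\<bbbA>\<^sup>J\<close>: the differential of the restriction at \<open>x\<close> is the
  ambient differential restricted to the tangent space of \<open>M\<close> at \<open>x\<close>.
\<close>

definition Sing ::
  "'x::real_normed_vector set \<Rightarrow> 'k set \<Rightarrow> ('x \<Rightarrow> 'a::real_normed_vector ^ 'k::finite) \<Rightarrow> 'x set" where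
  "Sing M J g = {x \<in> M. frechet_derivative g (at x) ` tangent_space M x \<noteq> coord_subspace J}"

definition torus :: "('a::zero ^ 'n::finite) set" where
  "torus = {x. \<forall>i. x $ i \<noteq> 0}"

definition polyhedral_cone :: "(real ^ 'n::finite) set \<Rightarrow> bool"
  \<comment> \<open>Not necessarily closed: strict and non-strict linear inequalities are both allowed.\<close>
  where
  "polyhedral_cone \<sigma> \<longleftrightarrow> (\<exists>A B. finite A \<and> finite B \<and>
      \<sigma> = {p. (\<forall>a\<in>A. 0 \<le> a \<bullet> p) \<and> (\<forall>b\<in>B. 0 < b \<bullet> p)})"

definition vec_of :: "nat ^ 'n::finite \<Rightarrow> real ^ 'n" where
  "vec_of \<nu> = (\<chi> i. real (\<nu> $ i))"

text \<open>
  The real, complex and mixed cases are treated uniformly. A polynomial is a finitely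
  supported family of coefficients indexed by a type \<open>'e\<close> of monomials; \<open>mon\<close> evaluates a
  monomial and \<open>expo\<close> gives the lattice point that it contributes to the support.
\<close>

locale monomials =
  fixes expo :: "'e \<Rightarrow> nat ^ 'n::finite"
    and mon :: "'e \<Rightarrow> 'a::{real_normed_field,euclidean_space} ^ 'n \<Rightarrow> 'a"
begin

definition ev :: "('e \<Rightarrow>\<^sub>0 'a) \<Rightarrow> 'a ^ 'n \<Rightarrow> 'a" where
  "ev f x = (\<Sum>e\<in>Poly_Mapping.keys f. Poly_Mapping.lookup f e * mon e x)"

definition supp :: "('e \<Rightarrow>\<^sub>0 'a) \<Rightarrow> (real ^ 'n) set" where
  "supp f = (\<lambda>e. vec_of (expo e)) ` Poly_Mapping.keys f"

definition Gamma0 :: "('e \<Rightarrow>\<^sub>0 'a) \<Rightarrow> (real ^ 'n) set" where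
  "Gamma0 f = convex hull (insert 0 (supp f))"

definition part :: "('e \<Rightarrow>\<^sub>0 'a) \<Rightarrow> (real ^ 'n) set \<Rightarrow> 'a ^ 'n \<Rightarrow> 'a" where
  "part f \<Delta> x =
     (\<Sum>e | e \<in> Poly_Mapping.keys f \<and> vec_of (expo e) \<in> \<Delta>. Poly_Mapping.lookup f e * mon e x)"

definition min_face :: "('e \<Rightarrow>\<^sub>0 'a) \<Rightarrow> real ^ 'n \<Rightarrow> (real ^ 'n) set" where
  "min_face f p = {v \<in> Gamma0 f. \<forall>w\<in>Gamma0 f. p \<bullet> v \<le> p \<bullet> w}"

definition pmap :: "('k::finite \<Rightarrow> 'e \<Rightarrow>\<^sub>0 'a) \<Rightarrow> 'a ^ 'n \<Rightarrow> 'a ^ 'k" where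
  "pmap F x = (\<chi> j. ev (F j) x)"

definition depends_on_all_variables :: "('k::finite \<Rightarrow> 'e \<Rightarrow>\<^sub>0 'a) \<Rightarrow> bool" where
  "depends_on_all_variables F \<longleftrightarrow>
     (\<forall>i. \<exists>j. \<exists>e\<in>Poly_Mapping.keys (F j). expo e $ i \<noteq> 0)"

definition face_equiv :: "('k::finite \<Rightarrow> 'e \<Rightarrow>\<^sub>0 'a) \<Rightarrow> real ^ 'n \<Rightarrow> real ^ 'n \<Rightarrow> bool" where
  "face_equiv F p p' \<longleftrightarrow> (\<forall>j. min_face (F j) p = min_face (F j) p')"

text \<open>
  The subdivision of the equivalence classes into convex polyhedral cones involves a choice;
  the predicate describes all admissible choices. The linear forms \<open>p\<close> are real: a cone of
  a chosen subdivision need not contain integral vectors. Members of a partition are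
  nonempty, so the choice of \<open>p \<in> \<sigma>\<close> in \<open>face\<close> is meaningful.
\<close>

definition dual_subdivision ::
  "('k::finite \<Rightarrow> 'e \<Rightarrow>\<^sub>0 'a) \<Rightarrow> (real ^ 'n) set set \<Rightarrow> bool" where
  "dual_subdivision F C \<longleftrightarrow>
     finite C \<and> partition_on {p. \<exists>i. p $ i < 0} C \<and>
     (\<forall>\<sigma>\<in>C. polyhedral_cone \<sigma> \<and> (\<forall>p\<in>\<sigma>. \<forall>p'\<in>\<sigma>. face_equiv F p p'))"

definition face :: "('k::finite \<Rightarrow> 'e \<Rightarrow>\<^sub>0 'a) \<Rightarrow> (real ^ 'n) set \<Rightarrow> 'k \<Rightarrow> (real ^ 'n) set" where
  "face F \<sigma> j = min_face (F j) (SOME p. p \<in> \<sigma>)"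

definition I_set :: "('k::finite \<Rightarrow> 'e \<Rightarrow>\<^sub>0 'a) \<Rightarrow> (real ^ 'n) set \<Rightarrow> 'k set" where
  "I_set F \<sigma> = {j. 0 \<notin> face F \<sigma> j}"

definition J_set :: "('k::finite \<Rightarrow> 'e \<Rightarrow>\<^sub>0 'a) \<Rightarrow> (real ^ 'n) set \<Rightarrow> 'k set" where
  "J_set F \<sigma> = {j. face F \<sigma> j = {0}}"

definition face_map ::
  "('k::finite \<Rightarrow> 'e \<Rightarrow>\<^sub>0 'a) \<Rightarrow> (real ^ 'n) set \<Rightarrow> 'k set \<Rightarrow> 'a ^ 'n \<Rightarrow> 'a ^ 'k" where
  "face_map F \<sigma> J x = (\<chi> j. if j \<in> J then part (F j) (face F \<sigma> j) x else 0)"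

definition G_set :: "('k::finite \<Rightarrow> 'e \<Rightarrow>\<^sub>0 'a) \<Rightarrow> (real ^ 'n) set \<Rightarrow> ('a ^ 'n) set" where
  "G_set F \<sigma> = {x \<in> torus. \<forall>j\<in>I_set F \<sigma>. part (F j) (face F \<sigma> j) x = 0}"

definition nondegenerate_at_infinity ::
  "('k::finite \<Rightarrow> 'e \<Rightarrow>\<^sub>0 'a) \<Rightarrow> (real ^ 'n) set set \<Rightarrow> bool" where
  "nondegenerate_at_infinity F C \<longleftrightarrow>
     (\<forall>\<sigma>\<in>C. I_set F \<sigma> \<noteq> {} \<and> J_set F \<sigma> = {} \<longrightarrow>
        Sing UNIV (I_set F \<sigma>) (face_map F \<sigma> (I_set F \<sigma>)) \<inter> G_set F \<sigma> = {})"

definition N_set :: "('k::finite \<Rightarrow> 'e \<Rightarrow>\<^sub>0 'a) \<Rightarrow> (real ^ 'n) set set \<Rightarrow> ('a ^ 'k) set" where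
  "N_set F C = (\<Union>\<sigma>\<in>{\<sigma>\<in>C. J_set F \<sigma> \<noteq> {}}. {z. \<forall>j\<in>J_set F \<sigma>. z $ j = 0})"

definition Disc_face :: "('k::finite \<Rightarrow> 'e \<Rightarrow>\<^sub>0 'a) \<Rightarrow> (real ^ 'n) set \<Rightarrow> ('a ^ 'k) set" where
  "Disc_face F \<sigma> =
     (let g = face_map F \<sigma> (- I_set F \<sigma>) in g ` Sing (G_set F \<sigma>) (- I_set F \<sigma>) g)"

definition A_set :: "('k::finite \<Rightarrow> 'e \<Rightarrow>\<^sub>0 'a) \<Rightarrow> (real ^ 'n) set set \<Rightarrow> ('a ^ 'k) set" where
  "A_set F C = (\<Union>\<sigma>\<in>{\<sigma>\<in>C. J_set F \<sigma> = {} \<and> - I_set F \<sigma> \<noteq> {}}.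
     coord_proj (- I_set F \<sigma>) -` Disc_face F \<sigma>)"

end

text \<open>
  Ordinary polynomials, over \<open>\<real>\<close> or \<open>\<complex>\<close>, and mixed polynomials, whose monomials
  \<open>z\<^sup>\<nu> (cnj z)\<^sup>\<mu>\<close> are indexed by pairs \<open>(\<nu>, \<mu>)\<close>.
\<close>

definition pure_mon :: "nat ^ 'n::finite \<Rightarrow> 'a::comm_monoid_mult ^ 'n \<Rightarrow> 'a" where
  "pure_mon \<nu> x = (\<Prod>i\<in>UNIV. (x $ i) ^ (\<nu> $ i))"

definition mixed_expo :: "(nat ^ 'n::finite) \<times> (nat ^ 'n) \<Rightarrow> nat ^ 'n" where
  "mixed_expo e = fst e + snd e"

definition mixed_mon :: "(nat ^ 'n::finite) \<times> (nat ^ 'n) \<Rightarrow> complex ^ 'n \<Rightarrow> complex" where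
  "mixed_mon e z = (\<Prod>i\<in>UNIV. (z $ i) ^ (fst e $ i) * cnj (z $ i) ^ (snd e $ i))"

interpretation pure: monomials "\<lambda>\<nu>. \<nu>" pure_mon .

interpretation mixed: monomials mixed_expo mixed_mon .

end

theory Submission
  imports Defs
begin

text \<open>
  Instead of the curve selection lemma, the argument works with the given sequence. By density
  it may be moved into the torus, together with unit covectors that nearly attain \<open>nu\<close>. After
  passing to a subsequence one writes \<open>x\<^sub>i = exp (- q\<^sub>i) y\<^sub>i\<close> with \<open>y\<close> converging to a point \<open>a\<close>
  of the torus, where along \<open>q\<close> each of the finitely many relevant differences of exponents
  either vanishes identically or tends to \<open>\<plusminus>\<infinity>\<close>. Separating the convex hull of those tending to
  \<open>\<infinity>\<close> from the subspace of bounded ones yields a single linear form \<open>p\<close> with the same signs,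
  and hence a cone \<open>\<sigma> \<ni> p\<close>: suitably normalised, \<open>f\<^sub>j\<close> and its logarithmic derivatives at \<open>x\<close>
  converge to those of its face part at \<open>a\<close>. A limit of rescaled covectors annihilates the
  differential of \<open>(f\<^sub>\<Delta>\<^sub>j)\<^sub>j\<close> over all \<open>j\<close> at \<open>a\<close>. If \<open>J\<^sub>\<sigma> = {}\<close>, non-degeneracy then makes \<open>a\<close> a
  singular point of \<open>F\<^sub>\<sigma>\<close> on \<open>G\<^sub>\<sigma>\<close>, whose value is the projection of \<open>c\<close>.
\<close>

section \<open>Growth directions of sequences\<close>

text \<open>By compactness of the extended real line a subsequence has a limit there; the
  alternatives correspond to a finite limit, infinity and minus infinity.\<close>

lemma subseq_bounded_or_divergent:
  fixes X :: "nat \<Rightarrow> real"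
  obtains r where "strict_mono r"
    "bounded (range (X \<circ> r)) \<or> filterlim (X \<circ> r) at_top sequentially \<or> filterlim (X \<circ> r) at_bot sequentially"
proof -
  obtain l r where r: "strict_mono r" and l: "((\<lambda>n. ereal (X n)) \<circ> r) \<longlonglongrightarrow> l"
    using compact_complete_linorder by blast
  have l': "(\<lambda>n. ereal ((X \<circ> r) n)) \<longlonglongrightarrow> l" using l by (simp add: o_def)
  have "bounded (range (X \<circ> r)) \<or> filterlim (X \<circ> r) at_top sequentially \<or> filterlim (X \<circ> r) at_bot sequentially"
  proof (cases l)
    case (real c)
    then have "(X \<circ> r) \<longlonglongrightarrow> c" using l' by (simp add: o_def)
    then show ?thesis using convergent_imp_bounded by blast
  next
    case PInf
    then show ?thesis using l' tendsto_PInfty_eq_at_top by blast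
  next
    case MInf
    then have "(\<lambda>n. - ereal ((X \<circ> r) n)) \<longlonglongrightarrow> \<infinity>"
      using l' tendsto_uminus_ereal by fastforce
    then have "(\<lambda>n. ereal (- (X \<circ> r) n)) \<longlonglongrightarrow> \<infinity>" by simp
    then have "filterlim (\<lambda>n. - (X \<circ> r) n) at_top sequentially"
      using tendsto_PInfty_eq_at_top by blast
    then show ?thesis by (simp add: filterlim_uminus_at_bot)
  qed
  with r show thesis by (rule that)
qed

text \<open>Each alternative survives passing to a further subsequence, so the finitely many
  directions can be treated one after another.\<close>

lemma subseq_bounded_or_divergent_inner:
  fixes u :: "nat \<Rightarrow> 'v::euclidean_space"
  assumes "finite W"
  shows "\<exists>r. strict_mono r \<and> (\<forall>w\<in>W. bounded (range (\<lambda>l. u (r l) \<bullet> w)) \<or>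
      filterlim (\<lambda>l. u (r l) \<bullet> w) at_top sequentially \<or> filterlim (\<lambda>l. u (r l) \<bullet> w) at_bot sequentially)"
  using assms
proof (induction W)
  case empty
  show ?case by (auto intro: strict_mono_id)
next
  case (insert w W)
  then obtain r where r: "strict_mono r" and rW: "\<And>w. w \<in> W \<Longrightarrow> bounded (range (\<lambda>l. u (r l) \<bullet> w)) \<or>
      filterlim (\<lambda>l. u (r l) \<bullet> w) at_top sequentially \<or> filterlim (\<lambda>l. u (r l) \<bullet> w) at_bot sequentially"
    by blast
  obtain s where s: "strict_mono s" and sw: "bounded (range ((\<lambda>l. u (r l) \<bullet> w) \<circ> s)) \<or>
      filterlim ((\<lambda>l. u (r l) \<bullet> w) \<circ> s) at_top sequentially \<or> filterlim ((\<lambda>l. u (r l) \<bullet> w) \<circ> s) at_bot sequentially"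
    by (rule subseq_bounded_or_divergent)
  have sub: "bounded (range (\<lambda>l. u (r (s l)) \<bullet> w')) \<or>
      filterlim (\<lambda>l. u (r (s l)) \<bullet> w') at_top sequentially \<or> filterlim (\<lambda>l. u (r (s l)) \<bullet> w') at_bot sequentially"
    if "w' \<in> W" for w'
    using rW[OF that]
  proof (elim disjE)
    assume "bounded (range (\<lambda>l. u (r l) \<bullet> w'))"
    then show ?thesis by (intro disjI1) (rule bounded_subset, auto)
  qed (auto intro: filterlim_compose[OF _ filterlim_subseq[OF s]])
  show ?case
    using strict_mono_o[OF r s] sw sub by (intro exI[of _ "r \<circ> s"]) (auto simp: o_def)
qed

text \<open>A fixed vector \<open>p\<close> records the growth of \<open>q\<close> in the direction
  \<open>w\<close>. A pairing that does not diverge must vanish identically, not just stay bounded,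
  so that its exponential is exactly 1.\<close>

definition growth_sign :: "(nat \<Rightarrow> 'v::real_inner) \<Rightarrow> 'v \<Rightarrow> 'v \<Rightarrow> bool" where
  "growth_sign q p w \<longleftrightarrow> (p \<bullet> w = 0 \<and> (\<forall>l. q l \<bullet> w = 0)) \<or>
        (p \<bullet> w > 0 \<and> filterlim (\<lambda>l. q l \<bullet> w) at_top sequentially) \<or>
        (p \<bullet> w < 0 \<and> filterlim (\<lambda>l. q l \<bullet> w) at_bot sequentially)"

text \<open>Orthogonal projection onto the directions with bounded pairing splits off a bounded
  \<open>b\<close>; the remainder \<open>q\<close> is orthogonal to those directions and still
  diverges wherever \<open>u\<close> does.\<close>

lemma separating_direction:
  fixes u :: "nat \<Rightarrow> 'v::euclidean_space"
  assumes "finite W"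
  obtains r q b b' p where "strict_mono r" "\<forall>l. u (r l) = q l + b l" "b \<longlonglongrightarrow> b'"
    "\<forall>w\<in>W. growth_sign q p w"
proof -
  obtain r where r: "strict_mono r" and rW: "\<And>w. w \<in> W \<Longrightarrow> bounded (range (\<lambda>l. u (r l) \<bullet> w)) \<or>
      filterlim (\<lambda>l. u (r l) \<bullet> w) at_top sequentially \<or> filterlim (\<lambda>l. u (r l) \<bullet> w) at_bot sequentially"
    using subseq_bounded_or_divergent_inner[OF assms, of u] by blast
  define T where "T = {w. bounded (range (\<lambda>l. u (r l) \<bullet> w))}"
  have subT: "subspace T"
  proof -
    have "bounded (range (\<lambda>l. c * (u (r l) \<bullet> w)))" if "bounded (range (\<lambda>l. u (r l) \<bullet> w))" for c w
      using bounded_linear_image[OF that bounded_linear_mult_right[of c]] by (simp add: image_image)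
    then show ?thesis
      unfolding T_def subspace_def by (auto simp: inner_add_right intro!: bounded_plus_comp)
  qed
  obtain B where B: "B \<subseteq> T" "pairwise orthogonal B" "\<And>x. x \<in> B \<Longrightarrow> norm x = 1"
      "independent B" "span B = T"
    using orthonormal_basis_subspace[OF subT] by metis
  have finB: "finite B" using B(4) by (rule independent_imp_finite)
  \<comment> \<open>The coefficients in the orthonormal basis are bounded by the definition of
    \<open>T\<close>; a further subsequence will make \<open>b\<close> converge.\<close>
  define b where "b l = (\<Sum>\<beta>\<in>B. (u (r l) \<bullet> \<beta>) *\<^sub>R \<beta>)" for l
  have bB: "b l \<bullet> \<beta> = u (r l) \<bullet> \<beta>" if "\<beta> \<in> B" for l \<beta>
  proof -
    have "b l \<bullet> \<beta> = (\<Sum>\<gamma>\<in>B. if \<gamma> = \<beta> then u (r l) \<bullet> \<beta> else 0)"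
      unfolding b_def inner_sum_left
    proof (rule sum.cong)
      fix \<gamma> assume "\<gamma> \<in> B"
      then show "(u (r l) \<bullet> \<gamma>) *\<^sub>R \<gamma> \<bullet> \<beta> = (if \<gamma> = \<beta> then u (r l) \<bullet> \<beta> else 0)"
        using B(2,3) that by (auto simp: pairwise_def orthogonal_def norm_eq_1)
    qed simp
    then show ?thesis using finB that by simp
  qed
  have q0: "(u (r l) - b l) \<bullet> w = 0" if "w \<in> T" for w l
  proof -
    have "w \<in> span B" using that B(5) by simp
    then show ?thesis
    proof (induction rule: span_induct_alt)
      case (step c x y)
      have "(u (r l) - b l) \<bullet> x = 0" using bB[OF step(1)] by (simp only: inner_diff_left)
      with step(2) show ?case by (simp only: inner_add_right inner_scaleR_right)
    qed simp
  qed
  have "bounded (range b)"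
  proof -
    have bdd: "bounded (range (\<lambda>l. (u (r l) \<bullet> \<beta>) *\<^sub>R \<beta>))" if "\<beta> \<in> B" for \<beta>
    proof -
      have "bounded (range (\<lambda>l. u (r l) \<bullet> \<beta>))" using that B(1) T_def by auto
      from bounded_linear_image[OF this bounded_linear_scaleR_left[of \<beta>]]
      show ?thesis by (simp add: image_image)
    qed
    have "bounded (range (\<lambda>l. \<Sum>\<beta>\<in>A. (u (r l) \<bullet> \<beta>) *\<^sub>R \<beta>))" if "finite A" "A \<subseteq> B" for A
      using that
    proof (induction A)
      case (insert \<beta> A)
      then show ?case using bounded_plus_comp[OF bdd[of \<beta>] insert.IH] by simp
    qed simp
    then show ?thesis using finB unfolding b_def by blast
  qed
  then obtain b' s where s: "strict_mono s" and bs: "(b \<circ> s) \<longlonglongrightarrow> b'"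
    using bounded_imp_convergent_subsequence by blast
  define q where "q l = u (r (s l)) - b (s l)" for l
  \<comment> \<open>Directions tending to minus infinity are reversed, so that \<open>p\<close> has
    to be positive on all of \<open>U\<close>.\<close>
  define U where "U = {w\<in>W. filterlim (\<lambda>l. u (r l) \<bullet> w) at_top sequentially} \<union>
     uminus ` {w\<in>W. filterlim (\<lambda>l. u (r l) \<bullet> w) at_bot sequentially}"
  have finU: "finite U" unfolding U_def using assms by auto
  have Utop: "filterlim (\<lambda>l. u (r l) \<bullet> w) at_top sequentially" if "w \<in> U" for w
    using that unfolding U_def by (auto simp: filterlim_uminus_at_top)
  \<comment> \<open>A convex combination of pairings tending to infinity tends to infinity, so it
    cannot be bounded.\<close>
  have disj: "T \<inter> convex hull U = {}"
  proof (rule ccontr)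
    assume "\<not> ?thesis"
    then obtain y where y: "y \<in> T" "y \<in> convex hull U" by blast
    have "filterlim (\<lambda>l. u (r l) \<bullet> y) at_top sequentially"
      if "y \<in> convex hull U" for y
    proof -
      have "convex {y. filterlim (\<lambda>l. u (r l) \<bullet> y) at_top sequentially}"
      proof (rule convexI, clarsimp simp: inner_add_right)
        fix x y and \<alpha> \<beta> :: real
        assume *: "filterlim (\<lambda>l. u (r l) \<bullet> x) at_top sequentially"
           "filterlim (\<lambda>l. u (r l) \<bullet> y) at_top sequentially" "0 \<le> \<alpha>" "0 \<le> \<beta>" "\<alpha> + \<beta> = 1"
        have m: "filterlim (\<lambda>l. \<gamma> * (u (r l) \<bullet> z)) at_top sequentially"
          if "filterlim (\<lambda>l. u (r l) \<bullet> z) at_top sequentially" "\<gamma> > 0" for z \<gamma>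
          using filterlim_tendsto_pos_mult_at_top[OF tendsto_const that(2,1)] .
        consider "\<alpha> = 0" "\<beta> = 1" | "\<beta> = 0" "\<alpha> = 1" | "\<alpha> > 0" "\<beta> > 0" using * by linarith
        then show "filterlim (\<lambda>l. \<alpha> * (u (r l) \<bullet> x) + \<beta> * (u (r l) \<bullet> y)) at_top sequentially"
          by cases (use * in \<open>auto intro!: filterlim_at_top_add_at_top m\<close>)
      qed
      then have "convex hull U \<subseteq> {y. filterlim (\<lambda>l. u (r l) \<bullet> y) at_top sequentially}"
        using Utop by (intro hull_minimal) auto
      then show ?thesis using that by blast
    qed
    then have "filterlim (\<lambda>l. u (r l) \<bullet> y) at_top sequentially" using y by blast
    moreover obtain M where "\<And>l. \<bar>u (r l) \<bullet> y\<bar> \<le> M" using y unfolding T_def bounded_iff by auto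
    ultimately show False
      unfolding filterlim_at_top_dense eventually_sequentially
      by (meson abs_le_iff le_refl linorder_not_less)
  qed
  obtain p where pT: "\<And>w. w \<in> T \<Longrightarrow> p \<bullet> w = 0" and pU: "\<And>w. w \<in> U \<Longrightarrow> p \<bullet> w > 0"
  proof (cases "U = {}")
    case True
    then show thesis using that[of 0] by simp
  next
    case False
    obtain p c where pc: "\<And>w. w \<in> T \<Longrightarrow> p \<bullet> w < c" "\<And>w. w \<in> convex hull U \<Longrightarrow> p \<bullet> w > c"
      using separating_hyperplane_closed_compact[of T "convex hull U"] disj False finU
      by (metis subT subspace_imp_convex closed_subspace convex_convex_hull finite_imp_compact_convex_hull convex_hull_eq_empty)
    have c: "c > 0" using pc(1)[OF subspace_0[OF subT]] by simp
    \<comment> \<open>A linear form bounded above on a subspace vanishes there: otherwise some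
      multiple of \<open>w\<close> would have the value \<open>c\<close>.\<close>
    have "p \<bullet> w = 0" if "w \<in> T" for w
    proof (rule ccontr)
      assume n: "p \<bullet> w \<noteq> 0"
      have "(c / (p \<bullet> w)) *\<^sub>R w \<in> T" using subT that by (rule subspace_scale)
      from pc(1)[OF this] n show False by simp
    qed
    moreover have "p \<bullet> w > 0" if "w \<in> U" for w
      using pc(2)[of w] c that hull_inc[of w U] by fastforce
    ultimately show thesis using that by blast
  qed
  show thesis
  proof (rule that[of "r \<circ> s" q "b \<circ> s" b' p])
    show "strict_mono (r \<circ> s)" using r s by (rule strict_mono_o)
    show "\<forall>l. u ((r \<circ> s) l) = q l + (b \<circ> s) l" by (simp add: q_def)
    show "(b \<circ> s) \<longlonglongrightarrow> b'" by (rule bs)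
  next
    show "\<forall>w\<in>W. growth_sign q p w"
    proof
      fix w assume w: "w \<in> W"
      obtain K where K: "norm ((b \<circ> s) l) \<le> K" for l
        using convergent_imp_bounded[OF bs] by (auto simp: bounded_iff)
      \<comment> \<open>The bounded summand shifts each pairing by at most this constant, so it
        affects no divergence.\<close>
      have qb: "\<bar>u (r (s l)) \<bullet> w - q l \<bullet> w\<bar> \<le> K * norm w" for l
      proof -
        have "\<bar>(b \<circ> s) l \<bullet> w\<bar> \<le> norm ((b \<circ> s) l) * norm w" by (rule Cauchy_Schwarz_ineq2)
        also have "\<dots> \<le> K * norm w" using K by (intro mult_right_mono) auto
        finally show ?thesis by (simp add: q_def inner_diff_left)
      qed
      consider "w \<in> T" | "filterlim (\<lambda>l. u (r l) \<bullet> w) at_top sequentially" | "filterlim (\<lambda>l. u (r l) \<bullet> w) at_bot sequentially"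
        using rW[OF w] unfolding T_def by blast
      then show "growth_sign q p w"
      proof cases
        case 1
        then show ?thesis using pT q0 unfolding q_def growth_sign_def by blast
      next
        case 2
        have "filterlim (\<lambda>l. u (r (s l)) \<bullet> w) at_top sequentially"
          using filterlim_compose[OF 2 filterlim_subseq[OF s]] .
        from filterlim_tendsto_add_at_top[OF tendsto_const this, of "- (K * norm w)"]
        have "filterlim (\<lambda>l. u (r (s l)) \<bullet> w - K * norm w) at_top sequentially" by simp
        moreover have "u (r (s l)) \<bullet> w - K * norm w \<le> q l \<bullet> w" for l
          using qb[of l] by linarith
        ultimately have "filterlim (\<lambda>l. q l \<bullet> w) at_top sequentially"
          by (rule filterlim_at_top_mono[OF _ always_eventually[OF allI]])
        moreover have "w \<in> U" using 2 w unfolding U_def by blast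
        ultimately show ?thesis using pU unfolding growth_sign_def by blast
      next
        case 3
        then have 3: "filterlim (\<lambda>l. - (u (r (s l)) \<bullet> w)) at_top sequentially"
          using filterlim_compose[OF 3 filterlim_subseq[OF s]] by (simp add: filterlim_uminus_at_top)
        from filterlim_tendsto_add_at_top[OF tendsto_const this, of "- (K * norm w)"]
        have "filterlim (\<lambda>l. - (K * norm w) + - (u (r (s l)) \<bullet> w)) at_top sequentially" .
        moreover have "- (K * norm w) + - (u (r (s l)) \<bullet> w) \<le> - (q l \<bullet> w)" for l
          using qb[of l] by linarith
        ultimately have "filterlim (\<lambda>l. - (q l \<bullet> w)) at_top sequentially"
          by (rule filterlim_at_top_mono[OF _ always_eventually[OF allI]])
        then have "filterlim (\<lambda>l. q l \<bullet> w) at_bot sequentially" by (simp add: filterlim_uminus_at_bot)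
        moreover have "- w \<in> U" using \<open>filterlim (\<lambda>l. u (r l) \<bullet> w) at_bot sequentially\<close> w unfolding U_def by blast
        ultimately show ?thesis using pU[of "- w"] by (simp add: growth_sign_def)
      qed
    qed
  qed
qed

section \<open>Points of the torus: density and logarithmic rescaling\<close>

lemma eventually_torus:
  fixes x :: "'a::{real_normed_field,euclidean_space} ^ 'n::finite"
  shows "\<forall>\<^sub>F m in sequentially. (\<chi> i. x $ i + of_real (inverse (real (Suc m)))) \<in> torus"
proof -
  have "\<forall>\<^sub>F m in sequentially. x $ i + of_real (inverse (real (Suc m))) \<noteq> 0" for i
  proof (cases "x $ i = 0")
    case True
    then show ?thesis by (simp del: of_nat_Suc)
  next
    case False
    have "(\<lambda>m. x $ i + of_real (inverse (real (Suc m)))) \<longlonglongrightarrow> x $ i + of_real 0"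
      by (intro tendsto_intros LIMSEQ_inverse_real_of_nat)
    with False show ?thesis by (intro tendsto_imp_eventually_ne) auto
  qed
  then show ?thesis unfolding torus_def by (simp add: eventually_all_finite)
qed

lemma torus_approx:
  fixes x :: "'a::{real_normed_field,euclidean_space} ^ 'n::finite"
  assumes "open S" "x \<in> S"
  obtains y where "y \<in> torus" "y \<in> S"
proof -
  have "(\<lambda>m. \<chi> i. x $ i + of_real (inverse (real (Suc m)))) \<longlonglongrightarrow> (\<chi> i. x $ i + of_real 0)"
    by (intro tendsto_intros LIMSEQ_inverse_real_of_nat)
  then have "\<forall>\<^sub>F m in sequentially. (\<chi> i. x $ i + of_real (inverse (real (Suc m)))) \<in> S"
    using assms by (intro topological_tendstoD) auto
  then have "\<forall>\<^sub>F m in sequentially. (\<chi> i. x $ i + of_real (inverse (real (Suc m)))) \<in> torus \<inter> S"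
    using eventually_torus[of x] by eventually_elim simp
  then show thesis using that by (auto simp: eventually_sequentially)
qed

text \<open>The growth of the moduli is read off from the logarithms \<open>u\<close>: with
  \<open>u = q + b\<close>, removing the factors \<open>exp (- q)\<close> leaves coordinates of
  modulus \<open>exp (- b)\<close>, whose limits are positive. Compactness then provides
  \<open>a\<close>.\<close>

lemma torus_scaling:
  fixes x :: "nat \<Rightarrow> 'a::{real_normed_field,euclidean_space} ^ 'n::finite"
  assumes x: "\<And>l. x l \<in> torus" and "finite W"
  obtains r q y a p where "strict_mono r" "\<forall>l. x (r l) = (\<chi> i. exp (- (q l $ i)) *\<^sub>R y l $ i)"
    "y \<longlonglongrightarrow> a" "a \<in> torus"
    "\<forall>w\<in>W. growth_sign q p w"
proof -
  define u :: "nat \<Rightarrow> real ^ 'n" where "u l = (\<chi> i. - ln (norm (x l $ i)))" for l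
  obtain r q b b' p where r: "strict_mono r" and u: "\<forall>l. u (r l) = q l + b l" and b: "b \<longlonglongrightarrow> b'"
    and p: "\<forall>w\<in>W. growth_sign q p w"
    by (rule separating_direction[OF \<open>finite W\<close>, of u])
  define y :: "nat \<Rightarrow> 'a ^ 'n" where "y l = (\<chi> i. exp (q l $ i) *\<^sub>R x (r l) $ i)" for l
  have ny: "norm (y l $ i) = exp (- (b l $ i))" for l i
  proof -
    have "norm (x (r l) $ i) = exp (ln (norm (x (r l) $ i)))"
      using x[of "r l"] by (simp add: torus_def)
    also have "ln (norm (x (r l) $ i)) = - (q l $ i + b l $ i)"
      using arg_cong[OF u[rule_format, of l], of "\<lambda>v. v $ i"] by (simp add: u_def)
    finally show ?thesis by (simp add: y_def flip: exp_add)
  qed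
  have "(\<lambda>l. norm (y l)) \<longlonglongrightarrow> sqrt (\<Sum>i\<in>UNIV. (exp (- (b' $ i)))\<^sup>2)"
    unfolding norm_vec_def L2_set_def ny by (intro tendsto_intros b)
  then have "bounded (range (\<lambda>l. norm (y l)))" by (rule convergent_imp_bounded)
  then have "bounded (range y)" by (simp add: bounded_iff)
  then obtain a s where s: "strict_mono s" and ys: "(y \<circ> s) \<longlonglongrightarrow> a"
    using bounded_imp_convergent_subsequence by blast
  have "a $ i \<noteq> 0" for i
  proof -
    have "(\<lambda>l. norm ((y \<circ> s) l $ i)) \<longlonglongrightarrow> norm (a $ i)" by (intro tendsto_intros ys)
    moreover have "(\<lambda>l. exp (- ((b \<circ> s) l $ i))) \<longlonglongrightarrow> exp (- (b' $ i))"
      using LIMSEQ_subseq_LIMSEQ[OF b s] by (intro tendsto_intros)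
    ultimately have "norm (a $ i) = exp (- (b' $ i))"
      by (simp add: ny) (rule LIMSEQ_unique)
    then show ?thesis by auto
  qed
  then have a: "a \<in> torus" by (simp add: torus_def)
  show thesis
  proof (rule that[OF strict_mono_o[OF r s] _ ys a])
    show "\<forall>l. x ((r \<circ> s) l) = (\<chi> i. exp (- ((q \<circ> s) l $ i)) *\<^sub>R (y \<circ> s) l $ i)"
      by (simp add: y_def vec_eq_iff flip: exp_add)
    show "\<forall>w\<in>W. growth_sign (q \<circ> s) p w"
      using p unfolding growth_sign_def
      by (auto dest: filterlim_compose[OF _ filterlim_subseq[OF s]])
  qed
qed

section \<open>Polynomials and their face parts\<close>

lemma has_derivative_vec:
  fixes f :: "'x::real_normed_vector \<Rightarrow> 'k::finite \<Rightarrow> 'a::euclidean_space"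
  assumes "\<And>j. ((\<lambda>x. f x j) has_derivative f' j) (at x)"
  shows "((\<lambda>x. \<chi> j. f x j) has_derivative (\<lambda>v. \<chi> j. f' j v)) (at x)"
  unfolding has_derivative_componentwise_within[of "\<lambda>x. \<chi> j. f x j"]
  by (auto simp: Basis_vec_def inner_axis intro!: has_derivative_inner_left assms)

text \<open>The tangent space is only used through the inclusion \<open>T\<^sub>aG \<subseteq> ker dh\<close> for the
  defining map \<open>h\<close> of \<open>G\<close>; no implicit function theorem is needed.\<close>

lemma derivative_zero_on_tangent_space:
  assumes h: "(h has_derivative h') (at a)" and w: "w \<in> tangent_space M a"
    and M: "\<And>x. x \<in> M \<Longrightarrow> h x = 0"
  shows "h' w = 0"
proof -
  obtain \<gamma> \<epsilon> where \<gamma>: "\<epsilon> > 0" "\<gamma> (0::real) = a" "\<And>t. t \<in> {-\<epsilon><..<\<epsilon>} \<Longrightarrow> \<gamma> t \<in> M"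
    "(\<gamma> has_vector_derivative w) (at 0)"
    using w unfolding tangent_space_def by blast
  have "(h \<circ> \<gamma> has_derivative h' \<circ> (\<lambda>t. t *\<^sub>R w)) (at 0)"
    using h \<gamma>(2,4) unfolding has_vector_derivative_def by (intro diff_chain_at) auto
  moreover have "(h \<circ> \<gamma> has_derivative (\<lambda>_. 0)) (at 0)"
    by (rule has_derivative_transform_within_open[OF has_derivative_const[of 0], where s = "{-\<epsilon><..<\<epsilon>}"])
      (use \<gamma> M in auto)
  ultimately have "h' \<circ> (\<lambda>t. t *\<^sub>R w) = (\<lambda>_. 0)" by (rule has_derivative_unique)
  then show ?thesis by (auto dest: fun_cong[of _ _ 1])
qed

text \<open>The map \<open>cj\<close> is the conjugation for mixed polynomials; ordinary polynomials have
  \<open>anti = 0\<close> and take \<open>cj\<close> to be the identity.\<close>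

locale conj_monomials = monomials expo mon
  for expo :: "'e \<Rightarrow> nat ^ 'n::finite"
    and mon :: "'e \<Rightarrow> 'a::{real_normed_field,euclidean_space} ^ 'n \<Rightarrow> 'a" +
  fixes cj :: "'a \<Rightarrow> 'a" and hol anti :: "'e \<Rightarrow> nat ^ 'n"
  assumes cj_linear: "bounded_linear cj"
    and cj_mult: "cj (z * w) = cj z * cj w"
    and expo_eq: "expo e = hol e + anti e"
    and mon_eq: "mon e x = (\<Prod>i\<in>UNIV. (x $ i) ^ (hol e $ i) * cj (x $ i) ^ (anti e $ i))"
begin

section \<open>Scaling and differentiation of monomials\<close>

lemmas cj_scaleR = linear_cmul[OF bounded_linear.linear[OF cj_linear]]

text \<open>The scaling factors are real, so they pass through \<open>cj\<close>; the exponents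
  \<open>hol\<close> and \<open>anti\<close> therefore contribute equally to the weight.\<close>

lemma mon_exp_scale:
  "mon e (\<chi> i. exp (- (q $ i)) *\<^sub>R y $ i) = exp (- (q \<bullet> vec_of (expo e))) *\<^sub>R mon e y"
proof -
  have "mon e (\<chi> i. exp (- (q $ i)) *\<^sub>R y $ i) =
     (\<Prod>i\<in>UNIV. of_real (exp (- (q $ i * real (expo e $ i)))) * ((y $ i) ^ (hol e $ i) * cj (y $ i) ^ (anti e $ i)))"
    unfolding mon_eq
  proof (rule prod.cong)
    fix i
    have "exp (- (q $ i * real (expo e $ i))) = exp (- (q $ i)) ^ (hol e $ i) * exp (- (q $ i)) ^ (anti e $ i)"
      by (simp add: expo_eq ring_distribs exp_add flip: exp_of_nat_mult power_add) (simp add: mult.commute exp_add[symmetric])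
    then show "((\<chi> i. exp (- (q $ i)) *\<^sub>R y $ i) $ i) ^ (hol e $ i) * cj ((\<chi> i. exp (- (q $ i)) *\<^sub>R y $ i) $ i) ^ (anti e $ i) =
       of_real (exp (- (q $ i * real (expo e $ i)))) * ((y $ i) ^ (hol e $ i) * cj (y $ i) ^ (anti e $ i))"
      by (simp only: vec_lambda_beta cj_scaleR) (simp add: scaleR_conv_of_real power_mult_distrib)
  qed simp
  also have "\<dots> = of_real (\<Prod>i\<in>UNIV. exp (- (q $ i * real (expo e $ i)))) * mon e y"
    by (simp add: prod.distrib mon_eq)
  also have "(\<Prod>i\<in>UNIV. exp (- (q $ i * real (expo e $ i)))) = exp (- (q \<bullet> vec_of (expo e)))"
    by (simp add: exp_sum[symmetric] inner_vec_def vec_of_def sum_negf)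
  finally show ?thesis by (simp add: scaleR_conv_of_real)
qed

lemma mon_expo_0: "expo e = 0 \<Longrightarrow> mon e x = 1"
  by (simp add: mon_eq expo_eq vec_eq_iff)

lemma mon_at_0: "expo e \<noteq> 0 \<Longrightarrow> mon e 0 = 0"
proof -
  assume "expo e \<noteq> 0"
  then obtain i where "hol e $ i \<noteq> 0 \<or> anti e $ i \<noteq> 0" by (auto simp: vec_eq_iff expo_eq)
  then show ?thesis
    unfolding mon_eq using linear_0[OF bounded_linear.linear[OF cj_linear]] by (intro prod_zero) auto
qed

lemma continuous_on_mon: "continuous_on S (mon e)"
  unfolding mon_eq[abs_def]
  by (intro continuous_intros bounded_linear.continuous_on[OF cj_linear])

text \<open>This is the derivative at \<open>z\<close> in direction \<open>w\<close> of the
  \<open>i\<close>-th factor of a monomial, arranged as the product and power rules produce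
  it.\<close>

definition dfac where
  "dfac e i z w = (z ^ (hol e $ i)) * (of_nat (anti e $ i) * cj w * cj z ^ (anti e $ i - 1))
     + of_nat (hol e $ i) * w * z ^ (hol e $ i - 1) * cj z ^ (anti e $ i)"

definition dmon where
  "dmon e x v = (\<Sum>i\<in>UNIV. dfac e i (x $ i) (v $ i) *
     (\<Prod>j\<in>UNIV - {i}. (x $ j) ^ (hol e $ j) * cj (x $ j) ^ (anti e $ j)))"

text \<open>The factor by which a monomial is multiplied when it is differentiated in the direction
  \<open>x\<^sub>i b\<close> of the \<open>i\<close>-th coordinate.\<close>

definition logder where
  "logder e i b = of_nat (hol e $ i) * b + of_nat (anti e $ i) * cj b"

lemma mon_has_derivative: "(mon e has_derivative dmon e x) (at x)"
  unfolding mon_eq[abs_def] dmon_def[abs_def] dfac_def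
  by (rule has_derivative_prod)
    (intro has_derivative_mult has_derivative_power bounded_linear.has_derivative[OF cj_linear]
      bounded_linear.has_derivative[OF bounded_linear_vec_nth] has_derivative_ident)

lemma continuous_on_dmon: "continuous_on S (\<lambda>x. dmon e x v)"
  unfolding dmon_def dfac_def
  by (intro continuous_intros bounded_linear.continuous_on[OF cj_linear])

text \<open>As in Euler's identity, a direction proportional to the coordinate itself restores the
  power lost in differentiating, so these derivatives scale like the monomials.\<close>

lemma dmon_axis: "dmon e x (axis i (x $ i * b)) = mon e x * logder e i b"
proof -
  have z: "cj 0 = 0" using linear_0[OF bounded_linear.linear[OF cj_linear]] .
  \<comment> \<open>For \<open>n = 0\<close> the truncated exponent \<open>n - 1\<close> is
    harmless, since both sides carry the factor \<open>of_nat n\<close>.\<close>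
  have p: "of_nat n * (z * w) * z ^ (n - 1) = of_nat n * w * z ^ n" for z w :: 'a and n
    by (cases n) auto
  have fac: "dfac e i (x $ i) (x $ i * b) = (x $ i) ^ (hol e $ i) * cj (x $ i) ^ (anti e $ i) * logder e i b"
    unfolding dfac_def logder_def cj_mult p by (simp add: algebra_simps)
  have "dmon e x (axis i (x $ i * b)) = (\<Sum>j\<in>UNIV. if j = i then dfac e i (x $ i) (x $ i * b) *
     (\<Prod>j\<in>UNIV - {i}. (x $ j) ^ (hol e $ j) * cj (x $ j) ^ (anti e $ j)) else 0)"
    unfolding dmon_def by (intro sum.cong) (auto simp: axis_def dfac_def z)
  also have "\<dots> = mon e x * logder e i b"
    by (simp add: fac mon_eq prod.remove[of UNIV i])
  finally show ?thesis .
qed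

section \<open>Face parts, their derivatives and their limits\<close>

definition dpart where
  "dpart f \<Delta> x v = (\<Sum>e | e \<in> Poly_Mapping.keys f \<and> vec_of (expo e) \<in> \<Delta>. Poly_Mapping.lookup f e * dmon e x v)"

lemma part_has_derivative: "(part f \<Delta> has_derivative dpart f \<Delta> x) (at x)"
  unfolding part_def[abs_def] dpart_def[abs_def]
  by (intro has_derivative_sum has_derivative_mult_right mon_has_derivative)

lemma dpart_axis: "dpart f \<Delta> x (axis i (x $ i * b)) =
   (\<Sum>e | e \<in> Poly_Mapping.keys f \<and> vec_of (expo e) \<in> \<Delta>. Poly_Mapping.lookup f e * (mon e x * logder e i b))"
  unfolding dpart_def dmon_axis ..

lemma ev_eq_part: "ev f = part f UNIV"
  by (auto simp: ev_def part_def fun_eq_iff)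

text \<open>Both sides are the constant term. Together with F(0) = 0 this will make the coordinates
  of \<open>c\<close> indexed by \<open>J_set\<close> vanish.\<close>

lemma part_zero_eq_ev: "part f {0} x = ev f 0"
proof -
  have "vec_of \<nu> = 0 \<longleftrightarrow> \<nu> = 0" for \<nu> :: "nat ^ 'n" by (simp add: vec_of_def vec_eq_iff)
  then have "part f {0} x = (\<Sum>e | e \<in> Poly_Mapping.keys f \<and> expo e = 0. Poly_Mapping.lookup f e * mon e 0)"
    unfolding part_def by (intro sum.cong) (auto simp: mon_expo_0)
  also have "\<dots> = ev f 0" unfolding ev_def
    by (rule sum.mono_neutral_left) (auto simp: mon_at_0)
  finally show ?thesis .
qed

text \<open>Once \<open>exp (- (q l \<bullet> \<nu>))\<close> is factored out, monomials on the face
  keep the exact factor 1 and all others decay. The weights \<open>\<kappa>\<close> cover both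
  values (\<open>\<kappa> = 1\<close>) and logarithmic derivatives
  (\<open>\<kappa> = logder\<close>).\<close>

lemma monomial_limit:
  assumes x: "\<And>l. x l = (\<chi> i. exp (- (q l $ i)) *\<^sub>R y l $ i)" and y: "y \<longlonglongrightarrow> a"
    and 0: "\<And>e l. e \<in> Poly_Mapping.keys f \<Longrightarrow> vec_of (expo e) \<in> \<Delta> \<Longrightarrow> q l \<bullet> (vec_of (expo e) - \<nu>) = 0"
    and top: "\<And>e. e \<in> Poly_Mapping.keys f \<Longrightarrow> vec_of (expo e) \<notin> \<Delta> \<Longrightarrow>
       filterlim (\<lambda>l. q l \<bullet> (vec_of (expo e) - \<nu>)) at_top sequentially"
  shows "(\<lambda>l. exp (q l \<bullet> \<nu>) *\<^sub>R (\<Sum>e\<in>Poly_Mapping.keys f. Poly_Mapping.lookup f e * (mon e (x l) * \<kappa> e)))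
     \<longlonglongrightarrow> (\<Sum>e | e \<in> Poly_Mapping.keys f \<and> vec_of (expo e) \<in> \<Delta>. Poly_Mapping.lookup f e * (mon e a * \<kappa> e))"
proof -
  have m: "(\<lambda>l. mon e (y l)) \<longlonglongrightarrow> mon e a" for e
    using continuous_on_tendsto_compose[OF continuous_on_mon[of UNIV e] y] by simp
  have "(\<lambda>l. exp (- (q l \<bullet> (vec_of (expo e) - \<nu>)))) \<longlonglongrightarrow> (if vec_of (expo e) \<in> \<Delta> then 1 else 0)"
    if e: "e \<in> Poly_Mapping.keys f" for e
  proof (cases "vec_of (expo e) \<in> \<Delta>")
    case True
    then show ?thesis using 0[OF e] by simp
  next
    case False
    then show ?thesis using top[OF e False]
      by (auto intro!: filterlim_compose[OF exp_at_bot] simp: filterlim_uminus_at_bot)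
  qed
  then have "(\<lambda>l. \<Sum>e\<in>Poly_Mapping.keys f. Poly_Mapping.lookup f e *
      ((exp (- (q l \<bullet> (vec_of (expo e) - \<nu>))) *\<^sub>R mon e (y l)) * \<kappa> e))
     \<longlonglongrightarrow> (\<Sum>e\<in>Poly_Mapping.keys f. Poly_Mapping.lookup f e * (((if vec_of (expo e) \<in> \<Delta> then 1 else 0) *\<^sub>R mon e a) * \<kappa> e))"
    by (intro tendsto_intros m) auto
  also have "(\<Sum>e\<in>Poly_Mapping.keys f. Poly_Mapping.lookup f e * (((if vec_of (expo e) \<in> \<Delta> then 1 else 0) *\<^sub>R mon e a) * \<kappa> e))
     = (\<Sum>e\<in>Poly_Mapping.keys f. if vec_of (expo e) \<in> \<Delta> then Poly_Mapping.lookup f e * (mon e a * \<kappa> e) else 0)"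
    by (intro sum.cong) auto
  also have "\<dots> = (\<Sum>e | e \<in> Poly_Mapping.keys f \<and> vec_of (expo e) \<in> \<Delta>. Poly_Mapping.lookup f e * (mon e a * \<kappa> e))"
    by (rule sum.inter_filter[symmetric]) simp
  finally have lim: "(\<lambda>l. \<Sum>e\<in>Poly_Mapping.keys f. Poly_Mapping.lookup f e *
      ((exp (- (q l \<bullet> (vec_of (expo e) - \<nu>))) *\<^sub>R mon e (y l)) * \<kappa> e))
     \<longlonglongrightarrow> (\<Sum>e | e \<in> Poly_Mapping.keys f \<and> vec_of (expo e) \<in> \<Delta>. Poly_Mapping.lookup f e * (mon e a * \<kappa> e))" .
  have "exp (q l \<bullet> \<nu>) *\<^sub>R (\<Sum>e\<in>Poly_Mapping.keys f. Poly_Mapping.lookup f e * (mon e (x l) * \<kappa> e)) =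
     (\<Sum>e\<in>Poly_Mapping.keys f. Poly_Mapping.lookup f e *
      ((exp (- (q l \<bullet> (vec_of (expo e) - \<nu>))) *\<^sub>R mon e (y l)) * \<kappa> e))" for l
    unfolding scaleR_sum_right
  proof (rule sum.cong)
    fix e
    have "exp (- (q l \<bullet> (vec_of (expo e) - \<nu>))) = exp (q l \<bullet> \<nu>) * exp (- (q l \<bullet> vec_of (expo e)))"
      by (simp add: inner_diff_right flip: exp_add)
    then show "exp (q l \<bullet> \<nu>) *\<^sub>R (Poly_Mapping.lookup f e * (mon e (x l) * \<kappa> e)) =
      Poly_Mapping.lookup f e * ((exp (- (q l \<bullet> (vec_of (expo e) - \<nu>))) *\<^sub>R mon e (y l)) * \<kappa> e)"
      by (simp only: x mon_exp_scale mult_scaleR_left mult_scaleR_right scaleR_scaleR)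
  qed simp
  with lim show ?thesis by simp
qed

section \<open>Tuples of face parts and their differentials\<close>

definition gmap where
  "gmap F \<Delta> J x = (\<chi> j. if j \<in> J then part (F j) (\<Delta> j) x else 0)"

definition dgmap where
  "dgmap F \<Delta> J x v = (\<chi> j. if j \<in> J then dpart (F j) (\<Delta> j) x v else 0)"

lemma gmap_has_derivative: "(gmap F \<Delta> J has_derivative dgmap F \<Delta> J x) (at x)"
  unfolding gmap_def[abs_def] dgmap_def[abs_def]
proof (rule has_derivative_vec)
  fix j show "((\<lambda>x. if j \<in> J then part (F j) (\<Delta> j) x else 0) has_derivative
      (\<lambda>v. if j \<in> J then dpart (F j) (\<Delta> j) x v else 0)) (at x)"
    by (cases "j \<in> J") (auto intro: part_has_derivative)
qed

lemma linear_dgmap: "linear (dgmap F \<Delta> J x)"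
  using gmap_has_derivative by (rule has_derivative_linear)

lemma continuous_on_dgmap: "continuous_on S (\<lambda>x. dgmap F \<Delta> J x v)"
proof -
  have "continuous_on S (\<lambda>x. if j \<in> J then dpart (F j) (\<Delta> j) x v else 0)" for j
    by (cases "j \<in> J") (auto simp: dpart_def intro!: continuous_intros continuous_on_dmon)
  then show ?thesis unfolding dgmap_def by (intro continuous_on_vec_lambda)
qed

text \<open>With the whole space in the role of each face, one derivative computation serves
  \<open>F\<close> and all its face maps.\<close>

lemma pmap_eq_gmap: "pmap F = gmap F (\<lambda>_. UNIV) UNIV"
  by (simp add: fun_eq_iff pmap_def gmap_def ev_eq_part)

lemma face_map_eq_gmap: "face_map F \<sigma> J = gmap F (face F \<sigma>) J"
  by (simp add: fun_eq_iff face_map_def gmap_def)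

section \<open>Faces on which a linear form is minimal\<close>

lemma min_face_iff:
  assumes "v \<in> insert 0 (supp f)"
  shows "v \<in> min_face f p \<longleftrightarrow> (\<forall>w\<in>insert 0 (supp f). p \<bullet> v \<le> p \<bullet> w)"
proof
  assume "v \<in> min_face f p"
  then show "\<forall>w\<in>insert 0 (supp f). p \<bullet> v \<le> p \<bullet> w"
    unfolding min_face_def Gamma0_def by (blast intro: hull_inc)
next
  assume *: "\<forall>w\<in>insert 0 (supp f). p \<bullet> v \<le> p \<bullet> w"
  \<comment> \<open>A half-space containing the generators contains their hull, so minimality need
    only be tested at the exponents and 0.\<close>
  have "convex hull (insert 0 (supp f)) \<subseteq> {w. p \<bullet> w \<ge> p \<bullet> v}"
    using * by (intro hull_minimal) (auto simp: convex_halfspace_ge)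
  then show "v \<in> min_face f p"
    using assms unfolding min_face_def Gamma0_def by (auto intro: hull_inc)
qed

text \<open>The point \<open>\<nu>\<close> will fix the normalisation of a component. Preferring 0
  makes the normalising factor 1 for faces through the origin, so that values of \<open>F\<close>
  are not rescaled there.\<close>

lemma min_face_vertex:
  obtains \<nu> where "\<nu> \<in> insert 0 (supp f)" "\<nu> \<in> min_face f p" "0 \<in> min_face f p \<longrightarrow> \<nu> = 0"
proof (cases "0 \<in> min_face f p")
  case True
  then show thesis using that[of 0] by simp
next
  case False
  have "finite (supp f)" by (simp add: supp_def)
  then obtain \<nu> where "is_arg_min (\<lambda>v. p \<bullet> v) (\<lambda>v. v \<in> insert 0 (supp f)) \<nu>"
    using ex_is_arg_min_if_finite[of "insert 0 (supp f)" "\<lambda>v. p \<bullet> v"] by auto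
  then have "\<nu> \<in> insert 0 (supp f)" "\<forall>w\<in>insert 0 (supp f). p \<bullet> \<nu> \<le> p \<bullet> w"
    by (auto simp: is_arg_min_linorder)
  then show thesis using that[of \<nu>] min_face_iff[of \<nu> f p] False by blast
qed

text \<open>The linear system is triangular: first the components in \<open>I\<close> are hit, then
  the others are corrected by a vector tangent to \<open>G\<close>, which leaves those in
  \<open>I\<close> unchanged. The empty cases are allowed for because non-degeneracy speaks only of
  nonempty \<open>I\<close> and \<open>A_set\<close> only of nonempty \<open>- I\<close>.\<close>

lemma surj_of_nonsingular:
  fixes F :: "'k::finite \<Rightarrow> 'e \<Rightarrow>\<^sub>0 'a" and \<Delta> :: "'k \<Rightarrow> (real ^ 'n) set"
  defines "d J a \<equiv> dgmap F \<Delta> J a"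
  assumes I: "I = {} \<or> a \<notin> Sing UNIV I (gmap F \<Delta> I)"
    and I': "- I = {} \<or> a \<notin> Sing G (- I) (gmap F \<Delta> (- I))"
    and G: "a \<in> G" "\<And>x. x \<in> G \<Longrightarrow> gmap F \<Delta> I x = 0"
  shows "surj (d UNIV a)"
proof -
  have fd: "frechet_derivative (gmap F \<Delta> J) (at a) = d J a" for J
    unfolding d_def by (rule frechet_derivative_at[OF gmap_has_derivative, symmetric])
  have lin: "linear (d J a)" for J unfolding d_def by (rule linear_dgmap)
  have "\<exists>v. d UNIV a v = y" for y
  proof -
    have "\<exists>v. d I a v = coord_proj I y"
    proof (cases "I = {}")
      case True
      then show ?thesis by (simp add: d_def dgmap_def coord_proj_def)
    next
      case False
      then have "d I a ` tangent_space UNIV a = coord_subspace I"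
        using I fd by (auto simp: Sing_def)
      moreover have "coord_proj I y \<in> coord_subspace I" by (simp add: coord_proj_def coord_subspace_def)
      ultimately show ?thesis by (metis imageE)
    qed
    then obtain v where v: "d I a v = coord_proj I y" ..
    have "\<exists>w. d (- I) a w = coord_proj (- I) y - d (- I) a v \<and> d I a w = 0"
    proof (cases "- I = {}")
      case True
      then have "d (- I) a w = coord_proj (- I) y - d (- I) a v" for w
        by (simp add: d_def dgmap_def coord_proj_def vec_eq_iff)
      then show ?thesis using linear_0[OF lin[of I]] by blast
    next
      case False
      then have "d (- I) a ` tangent_space G a = coord_subspace (- I)"
        using I' fd G(1) by (auto simp: Sing_def)
      moreover have "coord_proj (- I) y - d (- I) a v \<in> coord_subspace (- I)"
        by (simp add: coord_proj_def coord_subspace_def d_def dgmap_def)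
      ultimately obtain w where "w \<in> tangent_space G a" "d (- I) a w = coord_proj (- I) y - d (- I) a v"
        by (metis imageE)
      then show ?thesis
        using derivative_zero_on_tangent_space[OF gmap_has_derivative _ G(2)] unfolding d_def by blast
    qed
    then obtain w where w: "d (- I) a w = coord_proj (- I) y - d (- I) a v" "d I a w = 0" by blast
    have split: "d UNIV a u = d I a u + d (- I) a u" for u
      by (simp add: d_def dgmap_def vec_eq_iff)
    have "d UNIV a (v + w) = y"
      unfolding split linear_add[OF lin] v w by (simp add: coord_proj_def vec_eq_iff)
    then show ?thesis ..
  qed
  then show ?thesis by (metis surjI)
qed

section \<open>Asymptotic critical values\<close>

text \<open>A covector almost attaining \<open>nu\<close> is chosen at each \<open>X l\<close>. With
  it fixed, all conditions are open in the point, which can then be moved into the dense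
  torus.\<close>

lemma K_infinity_torus_sequence:
  fixes F :: "'k::finite \<Rightarrow> 'e \<Rightarrow>\<^sub>0 'a"
  assumes "c \<in> K_infinity (pmap F)"
  obtains x \<phi> where "\<forall>l. x l \<in> torus" "filterlim (\<lambda>l. norm (x l)) at_top sequentially"
    "(\<lambda>l. pmap F (x l)) \<longlonglongrightarrow> c" "\<forall>l. norm (\<phi> l) = 1"
    "(\<lambda>l. norm (x l) * norm (adjoint (dgmap F (\<lambda>_. UNIV) UNIV (x l)) (\<phi> l))) \<longlonglongrightarrow> 0"
proof -
  let ?D = "dgmap F (\<lambda>_. UNIV) UNIV"
  obtain X where X: "filterlim (\<lambda>l. norm (X l)) at_top sequentially" "(\<lambda>l. pmap F (X l)) \<longlonglongrightarrow> c"
    "(\<lambda>l. (1 + norm (X l)) * nu (frechet_derivative (pmap F) (at (X l)))) \<longlonglongrightarrow> 0"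
    using assms unfolding K_infinity_def by blast
  have fd: "frechet_derivative (pmap F) (at x) = ?D x" for x
    unfolding pmap_eq_gmap by (rule frechet_derivative_at[OF gmap_has_derivative, symmetric])
  define h where "h \<phi> x = (1 + norm x) * norm (adjoint (?D x) \<phi>)" for \<phi> x
  have cont: "continuous_on UNIV (h \<phi>)" for \<phi>
  proof -
    \<comment> \<open>Expanding the adjoint in the basis shows that it depends continuously on the
      point.\<close>
    have "adjoint (?D x) \<phi> = (\<Sum>\<beta>\<in>Basis. (?D x \<beta> \<bullet> \<phi>) *\<^sub>R \<beta>)" for x
    proof -
      have "adjoint (?D x) \<phi> \<bullet> \<beta> = ?D x \<beta> \<bullet> \<phi>" for \<beta>
        using adjoint_works[OF linear_dgmap] by (simp add: inner_commute)
      then show ?thesis using euclidean_representation[of "adjoint (?D x) \<phi>"] by simp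
    qed
    then show ?thesis unfolding h_def by (auto intro!: continuous_intros continuous_on_dgmap)
  qed
  have contF: "continuous_on UNIV (pmap F)"
    unfolding pmap_eq_gmap using gmap_has_derivative
    by (meson continuous_at_imp_continuous_on has_derivative_continuous)
  define \<epsilon> where "\<epsilon> l = inverse (real (Suc l))" for l
  have \<epsilon>0: "\<epsilon> l > 0" for l by (simp add: \<epsilon>_def)
  have \<epsilon>: "\<epsilon> \<longlonglongrightarrow> 0" unfolding \<epsilon>_def by (rule LIMSEQ_inverse_real_of_nat)
  have "\<exists>x \<phi>. x \<in> torus \<and> norm \<phi> = 1 \<and> dist x (X l) < 1 \<and> dist (pmap F x) (pmap F (X l)) < \<epsilon> l \<and>
     h \<phi> x < (1 + norm (X l)) * nu (?D (X l)) + 2 * \<epsilon> l" for l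
  proof -
    have pos: "1 + norm (X l) > 0" by (simp add: add_pos_nonneg)
    \<comment> \<open>The tolerance is divided by \<open>1 + norm (X l)\<close>, so that it costs
      one \<open>\<epsilon> l\<close> after multiplication; a second \<open>\<epsilon> l\<close>
      leaves room to move the point.\<close>
    have "nu (?D (X l)) < nu (?D (X l)) + \<epsilon> l / (1 + norm (X l))"
      using \<epsilon>0[of l] pos by simp
    moreover have "sphere 0 1 \<noteq> ({} :: ('a ^ 'k) set)" by simp
    ultimately have "\<exists>t\<in>(\<lambda>\<phi>. norm (adjoint (?D (X l)) \<phi>)) ` sphere 0 1. t < nu (?D (X l)) + \<epsilon> l / (1 + norm (X l))"
      unfolding nu_def by (intro cInf_lessD) auto
    then obtain \<phi> where \<phi>: "norm \<phi> = 1"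
       "norm (adjoint (?D (X l)) \<phi>) < nu (?D (X l)) + \<epsilon> l / (1 + norm (X l))"
      by auto
    have "h \<phi> (X l) < (1 + norm (X l)) * nu (?D (X l)) + \<epsilon> l"
      using mult_strict_left_mono[OF \<phi>(2) pos] pos unfolding h_def by (simp add: distrib_left)
    then have mem: "X l \<in> {x. dist x (X l) < 1} \<inter> {x. dist (pmap F x) (pmap F (X l)) < \<epsilon> l} \<inter>
        {x. h \<phi> x < (1 + norm (X l)) * nu (?D (X l)) + 2 * \<epsilon> l}"
      using \<epsilon>0[of l] by simp
    have "open ({x. dist x (X l) < 1} \<inter> {x. dist (pmap F x) (pmap F (X l)) < \<epsilon> l} \<inter>
        {x. h \<phi> x < (1 + norm (X l)) * nu (?D (X l)) + 2 * \<epsilon> l})"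
      by (intro open_Int open_Collect_less continuous_intros cont contF)
    from torus_approx[OF this mem] show ?thesis using \<phi>(1) by blast
  qed
  then obtain x \<phi> where x: "\<And>l. x l \<in> torus" "\<And>l. norm (\<phi> l) = 1" "\<And>l. dist (x l) (X l) < 1"
     "\<And>l. dist (pmap F (x l)) (pmap F (X l)) < \<epsilon> l"
     "\<And>l. h (\<phi> l) (x l) < (1 + norm (X l)) * nu (?D (X l)) + 2 * \<epsilon> l"
    by metis
  have 1: "filterlim (\<lambda>l. norm (x l)) at_top sequentially"
  proof (rule filterlim_at_top_mono[OF _ always_eventually[OF allI]])
    show "filterlim (\<lambda>l. - 1 + norm (X l)) at_top sequentially"
      by (rule filterlim_tendsto_add_at_top[OF tendsto_const X(1)])
    show "- 1 + norm (X l) \<le> norm (x l)" for l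
      using x(3)[of l] norm_triangle_ineq3[of "x l" "X l"] by (simp add: dist_norm)
  qed
  have 2: "(\<lambda>l. pmap F (x l)) \<longlonglongrightarrow> c"
  proof -
    have "(\<lambda>l. pmap F (x l) - pmap F (X l)) \<longlonglongrightarrow> 0"
      using x(4) by (intro Lim_null_comparison[OF _ \<epsilon>]) (auto simp: dist_norm less_imp_le)
    from tendsto_add[OF this X(2)] show ?thesis by simp
  qed
  have 3: "(\<lambda>l. norm (x l) * norm (adjoint (?D (x l)) (\<phi> l))) \<longlonglongrightarrow> 0"
  proof (rule Lim_null_comparison)
    show "(\<lambda>l. (1 + norm (X l)) * nu (?D (X l)) + 2 * \<epsilon> l) \<longlonglongrightarrow> 0"
      using tendsto_add[OF X(3) tendsto_mult_right[OF \<epsilon>, of 2]] by (simp add: fd mult.commute)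
    show "\<forall>\<^sub>F l in sequentially. norm (norm (x l) * norm (adjoint (?D (x l)) (\<phi> l))) \<le> (1 + norm (X l)) * nu (?D (X l)) + 2 * \<epsilon> l"
    proof (rule always_eventually, rule allI)
      fix l
      have "norm (x l) * norm (adjoint (?D (x l)) (\<phi> l)) \<le> h (\<phi> l) (x l)"
        unfolding h_def by (intro mult_right_mono) auto
      then show "norm (norm (x l) * norm (adjoint (?D (x l)) (\<phi> l))) \<le> (1 + norm (X l)) * nu (?D (X l)) + 2 * \<epsilon> l"
        using x(5)[of l] by simp
    qed
  qed
  show thesis using that x(1,2) 1 2 3 by blast
qed

text \<open>Division is possible on the torus, so a covector need only be tested on axis directions
  proportional to the coordinates.\<close>

lemma torus_axis_sum:
  assumes "a \<in> torus"
  shows "(\<Sum>i\<in>UNIV. axis i (a $ i * (v $ i / a $ i))) = (v :: 'a ^ 'n)"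
  using assms by (simp add: vec_eq_iff axis_def torus_def)

text \<open>The covectors \<open>\<phi> l\<close> are rescaled in each component by \<open>1 / R l $ j\<close>, which turns the
  logarithmic derivatives of \<open>F\<close> at \<open>x l\<close> into those of the face parts at \<open>a\<close>; as \<open>R l $ j \<le> 1\<close>,
  the rescaled covectors stay away from \<open>0\<close>.\<close>

lemma limit_covector:
  fixes F :: "'k::finite \<Rightarrow> 'e \<Rightarrow>\<^sub>0 'a" and R :: "nat \<Rightarrow> real ^ 'k"
  assumes x: "\<And>l. x l \<in> torus" and a: "a \<in> torus" and \<phi>: "\<And>l. norm (\<phi> l) = 1"
    and small: "(\<lambda>l. norm (x l) * norm (adjoint (dgmap F (\<lambda>_. UNIV) UNIV (x l)) (\<phi> l))) \<longlonglongrightarrow> 0"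
    and R0: "\<And>l j. 0 < R l $ j" and R1: "\<And>j. \<forall>\<^sub>F l in sequentially. R l $ j \<le> 1"
    and lim: "\<And>j i b. (\<lambda>l. R l $ j *\<^sub>R dpart (F j) UNIV (x l) (axis i (x l $ i * b)))
        \<longlonglongrightarrow> dpart (F j) (\<Delta> j) a (axis i (a $ i * b))"
  shows "\<not> surj (dgmap F \<Delta> UNIV a)"
proof -
  let ?D = "dgmap F (\<lambda>_. UNIV) UNIV" and ?d = "dgmap F \<Delta> UNIV a"
  define \<psi> :: "nat \<Rightarrow> 'a ^ 'k" where "\<psi> l = (\<chi> j. (1 / R l $ j) *\<^sub>R \<phi> l $ j)" for l
  have "\<psi> l \<noteq> 0" for l
  proof
    assume "\<psi> l = 0"
    then have "\<phi> l = 0" using R0[of l] by (simp add: \<psi>_def vec_eq_iff less_imp_neq[symmetric])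
    with \<phi>[of l] show False by simp
  qed
  then have n1: "norm (\<psi> l /\<^sub>R norm (\<psi> l)) = 1" for l by simp
  have "bounded (range (\<lambda>l. \<psi> l /\<^sub>R norm (\<psi> l)))" using n1 by (auto simp: bounded_iff)
  then obtain \<psi>' s where s: "strict_mono s" and \<psi>': "((\<lambda>l. \<psi> l /\<^sub>R norm (\<psi> l)) \<circ> s) \<longlonglongrightarrow> \<psi>'"
    using bounded_imp_convergent_subsequence by blast
  have "norm \<psi>' = 1"
    using LIMSEQ_unique[OF tendsto_norm[OF \<psi>']] n1 by (simp add: o_def)
  have annihilates: "?d (axis i (a $ i * b)) \<bullet> \<psi>' = 0" for i b
  proof -
    define \<omega> where "\<omega> l = ?D (x l) (axis i (x l $ i * b)) \<bullet> \<phi> l" for l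
    \<comment> \<open>The direction has norm at most \<open>norm (x l) * norm b\<close>; this is
      what the factor \<open>norm (x l)\<close> in the asymptotic condition compensates.\<close>
    have bound: "\<bar>\<omega> l\<bar> \<le> norm (x l) * norm (adjoint (?D (x l)) (\<phi> l)) * norm b" for l
    proof -
      have "norm (axis i (x l $ i * b)) = norm (x l $ i) * norm b"
        by (simp only: norm_eq_sqrt_inner[of "axis i (x l $ i * b)"] inner_axis_axis
            norm_eq_sqrt_inner[symmetric] norm_mult if_True simp_thms)
      also have "\<dots> \<le> norm (x l) * norm b" by (intro mult_right_mono Finite_Cartesian_Product.norm_nth_le) auto
      finally have "norm (axis i (x l $ i * b)) \<le> norm (x l) * norm b" .
      note le = this
      have "\<omega> l = axis i (x l $ i * b) \<bullet> adjoint (?D (x l)) (\<phi> l)"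
        unfolding \<omega>_def by (rule adjoint_works[OF linear_dgmap, symmetric])
      also have "\<bar>\<dots>\<bar> \<le> norm (axis i (x l $ i * b)) * norm (adjoint (?D (x l)) (\<phi> l))"
        by (rule Cauchy_Schwarz_ineq2)
      also have "\<dots> \<le> norm (x l) * norm b * norm (adjoint (?D (x l)) (\<phi> l))"
        by (rule mult_right_mono[OF le norm_ge_zero])
      finally show ?thesis by (simp only: mult_ac)
    qed
    have \<psi>1: "\<forall>\<^sub>F l in sequentially. norm (\<psi> l) \<ge> 1"
    proof -
      have "\<forall>\<^sub>F l in sequentially. \<forall>j. R l $ j \<le> 1" using R1 by (rule eventually_all_finite)
      then show ?thesis
      proof eventually_elim
        case (elim l)
        have "norm (\<phi> l) \<le> norm (\<psi> l)"
        proof (rule norm_le_componentwise_cart)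
          fix j
          have "1 * norm (\<phi> l $ j) \<le> (1 / R l $ j) * norm (\<phi> l $ j)"
            using elim R0[of l j] by (intro mult_right_mono) auto
          then show "norm (\<phi> l $ j) \<le> norm (\<psi> l $ j)" using R0[of l j] by (simp add: \<psi>_def)
        qed
        then show ?case by (simp add: \<phi>)
      qed
    qed
    have lim0: "(\<lambda>l. \<omega> l / norm (\<psi> l)) \<longlonglongrightarrow> 0"
    proof (rule Lim_null_comparison)
      show "(\<lambda>l. norm (x l) * norm (adjoint (?D (x l)) (\<phi> l)) * norm b) \<longlonglongrightarrow> 0"
        using tendsto_mult_left_zero[OF small] .
      show "\<forall>\<^sub>F l in sequentially. norm (\<omega> l / norm (\<psi> l)) \<le> norm (x l) * norm (adjoint (?D (x l)) (\<phi> l)) * norm b"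
        using \<psi>1
      proof eventually_elim
        case (elim l)
        have "norm (\<omega> l / norm (\<psi> l)) = \<bar>\<omega> l\<bar> / norm (\<psi> l)" by simp
        also have "\<dots> \<le> \<bar>\<omega> l\<bar> / 1" using elim by (intro divide_left_mono) auto
        finally show ?case using bound[of l] by simp
      qed
    qed
    \<comment> \<open>The factor \<open>R l $ j\<close> cancels its inverse in
      \<open>\<psi> l\<close>, so that both factors of each summand converge along
      \<open>s\<close>.\<close>
    have \<omega>: "\<omega> l / norm (\<psi> l) =
      (\<Sum>j\<in>UNIV. (R l $ j *\<^sub>R dpart (F j) UNIV (x l) (axis i (x l $ i * b))) \<bullet> (\<psi> l /\<^sub>R norm (\<psi> l)) $ j)" for l
      unfolding \<omega>_def inner_vec_def sum_divide_distrib
    proof (rule sum.cong)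
      fix j
      show "?D (x l) (axis i (x l $ i * b)) $ j \<bullet> \<phi> l $ j / norm (\<psi> l) =
        (R l $ j *\<^sub>R dpart (F j) UNIV (x l) (axis i (x l $ i * b))) \<bullet> (\<psi> l /\<^sub>R norm (\<psi> l)) $ j"
        using R0[of l j] by (simp add: dgmap_def \<psi>_def divide_inverse)
    qed simp
    have "(\<lambda>l. \<Sum>j\<in>UNIV. (R (s l) $ j *\<^sub>R dpart (F j) UNIV (x (s l)) (axis i (x (s l) $ i * b))) \<bullet>
         ((\<lambda>l. \<psi> l /\<^sub>R norm (\<psi> l)) \<circ> s) l $ j)
       \<longlonglongrightarrow> (\<Sum>j\<in>UNIV. dpart (F j) (\<Delta> j) a (axis i (a $ i * b)) \<bullet> \<psi>' $ j)"
      by (intro tendsto_intros \<psi>' LIMSEQ_subseq_LIMSEQ[OF lim s, unfolded o_def])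
    then have "(\<lambda>l. \<omega> (s l) / norm (\<psi> (s l))) \<longlonglongrightarrow> ?d (axis i (a $ i * b)) \<bullet> \<psi>'"
      by (simp add: \<omega> inner_vec_def dgmap_def)
    moreover have "(\<lambda>l. \<omega> (s l) / norm (\<psi> (s l))) \<longlonglongrightarrow> 0"
      using LIMSEQ_subseq_LIMSEQ[OF lim0 s] by (simp add: o_def)
    ultimately show ?thesis by (rule LIMSEQ_unique)
  qed
  have "?d v \<bullet> \<psi>' = 0" for v
  proof -
    have "?d v \<bullet> \<psi>' = (\<Sum>i\<in>UNIV. ?d (axis i (a $ i * (v $ i / a $ i))) \<bullet> \<psi>')"
      unfolding inner_sum_left[symmetric] linear_sum[OF linear_dgmap, symmetric] torus_axis_sum[OF a] ..
    also have "\<dots> = 0" by (rule sum.neutral) (blast intro: annihilates)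
    finally show ?thesis .
  qed
  then show ?thesis using \<open>norm \<psi>' = 1\<close> by (metis inner_eq_zero_iff norm_zero surjD zero_neq_one)
qed

theorem K_infinity_subset_N_set_A_set:
  fixes F :: "'k::finite \<Rightarrow> 'e \<Rightarrow>\<^sub>0 'a"
  assumes zero: "pmap F 0 = 0" and C: "dual_subdivision F C" and nondeg: "nondegenerate_at_infinity F C"
  shows "K_infinity (pmap F) \<subseteq> N_set F C \<union> A_set F C"
proof
  fix c assume "c \<in> K_infinity (pmap F)"
  then obtain x0 \<phi>0 where x0: "\<forall>l. x0 l \<in> torus" "filterlim (\<lambda>l. norm (x0 l)) at_top sequentially"
    "(\<lambda>l. pmap F (x0 l)) \<longlonglongrightarrow> c" "\<forall>l. norm (\<phi>0 l) = 1"
    "(\<lambda>l. norm (x0 l) * norm (adjoint (dgmap F (\<lambda>_. UNIV) UNIV (x0 l)) (\<phi>0 l))) \<longlonglongrightarrow> 0"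
    by (rule K_infinity_torus_sequence)
  define V where "V j = insert 0 (supp (F j))" for j
  have finV: "finite (V j)" for j by (simp add: V_def supp_def)
  \<comment> \<open>The axes tie the signs of the coordinates of \<open>p\<close> to the growth of
    those of \<open>q\<close>; the differences compare the monomials of one component with each
    other and with the origin, which belongs to \<open>Gamma0\<close>.\<close>
  define W where "W = range (\<lambda>i. axis i 1) \<union> (\<Union>j. (\<lambda>(v, w). v - w) ` (V j \<times> V j))"
  have "finite W" unfolding W_def using finV by auto
  with x0(1)[rule_format] obtain r q y a p where r: "strict_mono r"
    and xr: "\<forall>l. x0 (r l) = (\<chi> i. exp (- (q l $ i)) *\<^sub>R y l $ i)"
    and y: "y \<longlonglongrightarrow> a" and a: "a \<in> torus" and pW: "\<forall>w\<in>W. growth_sign q p w"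
    by (rule torus_scaling)
  define x \<phi> where "x = x0 \<circ> r" and "\<phi> = \<phi>0 \<circ> r"
  have x: "x l = (\<chi> i. exp (- (q l $ i)) *\<^sub>R y l $ i)" for l using xr by (simp add: x_def)
  have xtor: "x l \<in> torus" for l by (simp add: x_def x0)
  have xinf: "filterlim (\<lambda>l. norm (x l)) at_top sequentially"
    using filterlim_compose[OF x0(2) filterlim_subseq[OF r]] by (simp add: x_def)
  have Fx: "(\<lambda>l. pmap F (x l)) \<longlonglongrightarrow> c"
    using LIMSEQ_subseq_LIMSEQ[OF x0(3) r] by (simp add: x_def o_def)
  have \<phi>1: "norm (\<phi> l) = 1" for l by (simp add: \<phi>_def x0)
  have small: "(\<lambda>l. norm (x l) * norm (adjoint (dgmap F (\<lambda>_. UNIV) UNIV (x l)) (\<phi> l))) \<longlonglongrightarrow> 0"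
    using LIMSEQ_subseq_LIMSEQ[OF x0(5) r] by (simp add: x_def \<phi>_def o_def)
  \<comment> \<open>Otherwise every factor \<open>exp (- (q l $ i))\<close> would converge and the
    sequence would stay bounded. Hence \<open>p\<close> lies in the region partitioned by
    \<open>C\<close>.\<close>
  have "\<exists>i. p $ i < 0"
  proof (rule ccontr)
    assume "\<not> ?thesis"
    then have np: "\<not> p $ i < 0" for i by blast
    have bdd: "Bseq (\<lambda>l. x l $ i)" for i
    proof -
      have "growth_sign q p (axis i 1)" using pW by (simp add: W_def)
      then have "(\<forall>l. q l $ i = 0) \<or> filterlim (\<lambda>l. q l $ i) at_top sequentially"
        using np[of i] by (auto simp: growth_sign_def inner_axis)
      then obtain e where "(\<lambda>l. exp (- (q l $ i))) \<longlonglongrightarrow> e"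
      proof
        assume "filterlim (\<lambda>l. q l $ i) at_top sequentially"
        then have "(\<lambda>l. exp (- (q l $ i))) \<longlonglongrightarrow> 0"
          by (auto intro!: filterlim_compose[OF exp_at_bot] simp: filterlim_uminus_at_bot)
        then show thesis by (rule that)
      next
        assume "\<forall>l. q l $ i = 0"
        then show thesis using that[of 1] by simp
      qed
      then have "(\<lambda>l. exp (- (q l $ i)) *\<^sub>R y l $ i) \<longlonglongrightarrow> e *\<^sub>R a $ i"
        by (intro tendsto_intros y)
      then show ?thesis by (simp add: x) (metis convergent_def convergent_imp_Bseq)
    qed
    then obtain K where K: "\<And>i l. norm (x l $ i) \<le> K i" unfolding Bseq_def by metis
    have "norm (x l) \<le> (\<Sum>i\<in>UNIV. K i)" for l
    proof -
      have "norm (x l) \<le> (\<Sum>i\<in>UNIV. norm (x l $ i))"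
        unfolding norm_vec_def by (intro L2_set_le_sum) auto
      also have "\<dots> \<le> (\<Sum>i\<in>UNIV. K i)" by (intro sum_mono K)
      finally show ?thesis .
    qed
    with xinf show False
      unfolding filterlim_at_top_dense eventually_sequentially by (meson le_refl linorder_not_less)
  qed
  then obtain \<sigma> where \<sigma>: "\<sigma> \<in> C" "p \<in> \<sigma>"
    using C unfolding dual_subdivision_def partition_on_def by blast
  \<comment> \<open>All vectors of a cone select the same faces, so the choice made in
    \<open>face\<close> may be replaced by \<open>p\<close>.\<close>
  have face: "face F \<sigma> j = min_face (F j) p" for j
  proof -
    have "(SOME p. p \<in> \<sigma>) \<in> \<sigma>" using \<sigma>(2) by (rule someI)
    then show ?thesis
      using C \<sigma> unfolding dual_subdivision_def face_def face_equiv_def by blast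
  qed
  have "\<exists>\<nu>. \<nu> \<in> V j \<and> \<nu> \<in> face F \<sigma> j \<and> (0 \<in> face F \<sigma> j \<longrightarrow> \<nu> = 0)" for j
    unfolding face V_def using min_face_vertex by metis
  then obtain \<nu> where \<nu>V: "\<And>j. \<nu> j \<in> V j" and \<nu>face: "\<And>j. \<nu> j \<in> face F \<sigma> j"
    and \<nu>0: "\<And>j. 0 \<in> face F \<sigma> j \<Longrightarrow> \<nu> j = 0" by metis
  have diffW: "growth_sign q p (v - \<nu> j)" if "v \<in> V j" for v j
    using that \<nu>V[of j] pW unfolding W_def by force
  have face_iff: "v \<in> face F \<sigma> j \<longleftrightarrow> p \<bullet> (v - \<nu> j) = 0" and face_ge: "p \<bullet> (v - \<nu> j) \<ge> 0"
    if "v \<in> V j" for v j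
  proof -
    have \<nu>min: "p \<bullet> \<nu> j \<le> p \<bullet> w" if "w \<in> V j" for w
      using \<nu>face[of j] \<nu>V[of j] that min_face_iff[of "\<nu> j" "F j" p] unfolding face V_def by blast
    have "v \<in> face F \<sigma> j \<longleftrightarrow> (\<forall>w\<in>V j. p \<bullet> v \<le> p \<bullet> w)"
      using that unfolding face V_def by (rule min_face_iff)
    also have "\<dots> \<longleftrightarrow> p \<bullet> v = p \<bullet> \<nu> j"
      using \<nu>min \<nu>V[of j] that by (metis order_antisym)
    finally show "v \<in> face F \<sigma> j \<longleftrightarrow> p \<bullet> (v - \<nu> j) = 0" by (simp add: inner_diff_right)
    show "p \<bullet> (v - \<nu> j) \<ge> 0" using \<nu>min[OF that] by (simp add: inner_diff_right)
  qed
  have keyV: "vec_of (expo e) \<in> V j" if "e \<in> Poly_Mapping.keys (F j)" for e j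
    using that by (simp add: V_def supp_def)
  \<comment> \<open>Up to bounded factors, this is the inverse size of the dominating monomials of
    component \<open>j\<close> along the sequence.\<close>
  define R :: "nat \<Rightarrow> real ^ 'k" where "R l = (\<chi> j. exp (q l \<bullet> \<nu> j))" for l
  have lim: "(\<lambda>l. R l $ j *\<^sub>R (\<Sum>e\<in>Poly_Mapping.keys (F j). Poly_Mapping.lookup (F j) e * (mon e (x l) * \<kappa> e)))
     \<longlonglongrightarrow> (\<Sum>e | e \<in> Poly_Mapping.keys (F j) \<and> vec_of (expo e) \<in> face F \<sigma> j. Poly_Mapping.lookup (F j) e * (mon e a * \<kappa> e))"
    for j \<kappa>
    unfolding R_def vec_lambda_beta
  proof (rule monomial_limit[OF x y])
    fix e assume e: "e \<in> Poly_Mapping.keys (F j)"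
    note * = diffW[OF keyV[OF e]] face_iff[OF keyV[OF e]] face_ge[OF keyV[OF e]]
    show "q l \<bullet> (vec_of (expo e) - \<nu> j) = 0" if "vec_of (expo e) \<in> face F \<sigma> j" for l
      using * that unfolding growth_sign_def by force
    show "filterlim (\<lambda>l. q l \<bullet> (vec_of (expo e) - \<nu> j)) at_top sequentially" if "vec_of (expo e) \<notin> face F \<sigma> j"
      using * that unfolding growth_sign_def by force
  qed
  have limF: "(\<lambda>l. R l $ j *\<^sub>R pmap F (x l) $ j) \<longlonglongrightarrow> part (F j) (face F \<sigma> j) a" for j
    using lim[of j "\<lambda>_. 1"] by (simp add: pmap_def ev_def part_def)
  have Rface: "R l $ j = 1" if "0 \<in> face F \<sigma> j" for l j
    using \<nu>0[OF that] by (simp add: R_def)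
  \<comment> \<open>With the origin off the face, \<open>q l \<bullet> (0 - \<nu> j)\<close> tends
    to infinity: the dominating monomials blow up.\<close>
  have Rnface: "(\<lambda>l. R l $ j) \<longlonglongrightarrow> 0" if "0 \<notin> face F \<sigma> j" for j
  proof -
    have 0: "0 \<in> V j" by (simp add: V_def)
    have "filterlim (\<lambda>l. q l \<bullet> (0 - \<nu> j)) at_top sequentially"
      using diffW[OF 0] face_iff[OF 0] face_ge[OF 0] that unfolding growth_sign_def by force
    then have "filterlim (\<lambda>l. q l \<bullet> \<nu> j) at_bot sequentially" by (simp add: filterlim_uminus_at_bot)
    then show ?thesis unfolding R_def vec_lambda_beta by (rule filterlim_compose[OF exp_at_bot])
  qed
  have part_c: "part (F j) (face F \<sigma> j) a = c $ j" if "0 \<in> face F \<sigma> j" for j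
  proof (rule LIMSEQ_unique[OF limF])
    show "(\<lambda>l. R l $ j *\<^sub>R pmap F (x l) $ j) \<longlonglongrightarrow> c $ j"
      using Rface[OF that] by (simp add: tendsto_vec_nth[OF Fx])
  qed
  \<comment> \<open>The values of \<open>F\<close> converge while \<open>R\<close> tends to 0, so
    the rescaled values tend to 0; this places \<open>a\<close> in
    \<open>G_set F \<sigma>\<close>.\<close>
  have part_0: "part (F j) (face F \<sigma> j) a = 0" if "0 \<notin> face F \<sigma> j" for j
  proof (rule LIMSEQ_unique[OF limF])
    show "(\<lambda>l. R l $ j *\<^sub>R pmap F (x l) $ j) \<longlonglongrightarrow> 0"
      using tendsto_scaleR[OF Rnface[OF that] tendsto_vec_nth[OF Fx]] by simp
  qed
  show "c \<in> N_set F C \<union> A_set F C"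
  proof (cases "J_set F \<sigma> = {}")
    case False
    have "c $ j = 0" if "j \<in> J_set F \<sigma>" for j
    proof -
      have "face F \<sigma> j = {0}" using that by (simp add: J_set_def)
      then have "c $ j = ev (F j) 0" using part_c[of j] part_zero_eq_ev by auto
      also have "\<dots> = 0" using arg_cong[OF zero, of "\<lambda>z. z $ j"] by (simp add: pmap_def)
      finally show ?thesis .
    qed
    then have "c \<in> N_set F C" using False \<sigma>(1) unfolding N_set_def by blast
    then show ?thesis ..
  next
    case True
    define I where "I = I_set F \<sigma>"
    have aG: "a \<in> G_set F \<sigma>" using a part_0 by (auto simp: G_set_def I_set_def)
    have "\<not> surj (dgmap F (face F \<sigma>) UNIV a)"
    proof (rule limit_covector[OF xtor a \<phi>1 small])
      show "0 < R l $ j" for l j by (simp add: R_def)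
      show "\<forall>\<^sub>F l in sequentially. R l $ j \<le> 1" for j
      proof (cases "0 \<in> face F \<sigma> j")
        case True
        then show ?thesis by (simp add: Rface)
      next
        case False
        from order_tendstoD(2)[OF Rnface[OF this] zero_less_one] show ?thesis
          by eventually_elim simp
      qed
      show "(\<lambda>l. R l $ j *\<^sub>R dpart (F j) UNIV (x l) (axis i (x l $ i * b)))
        \<longlonglongrightarrow> dpart (F j) (face F \<sigma> j) a (axis i (a $ i * b))" for j i b
        unfolding dpart_axis using lim[of j "\<lambda>e. logder e i b"] by simp
    qed
    moreover have "I = {} \<or> a \<notin> Sing UNIV I (gmap F (face F \<sigma>) I)"
      using nondeg \<sigma>(1) True aG unfolding nondegenerate_at_infinity_def face_map_eq_gmap I_def by blast
    moreover have "gmap F (face F \<sigma>) I z = 0" if "z \<in> G_set F \<sigma>" for z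
      using that by (simp add: gmap_def G_set_def I_def vec_eq_iff)
    \<comment> \<open>If \<open>- I\<close> were empty or \<open>a\<close> nonsingular on
      \<open>G_set F \<sigma>\<close>, the full differential would be onto, contrary to the limit
      covector.\<close>
    ultimately have "- I \<noteq> {}" "a \<in> Sing (G_set F \<sigma>) (- I) (gmap F (face F \<sigma>) (- I))"
      using surj_of_nonsingular[of I a F "face F \<sigma>" "G_set F \<sigma>"] aG by auto
    \<comment> \<open>Outside \<open>I\<close> the face contains the origin, so no rescaling took
      place and the face parts take the values \<open>c $ j\<close> at \<open>a\<close>.\<close>
    moreover have "coord_proj (- I) c = gmap F (face F \<sigma>) (- I) a"
      using part_c by (simp add: coord_proj_def gmap_def vec_eq_iff I_def I_set_def)
    ultimately have "c \<in> A_set F C"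
      using \<sigma>(1) True unfolding A_set_def Disc_face_def Let_def face_map_eq_gmap I_def by blast
    then show ?thesis ..
  qed
qed

end

section \<open>The real, complex and mixed cases\<close>

lemma conj_monomials_pure:
  "conj_monomials (\<lambda>\<nu>. \<nu>) (pure_mon :: nat ^ 'n::finite \<Rightarrow> 'a::{real_normed_field,euclidean_space} ^ 'n \<Rightarrow> 'a)
     (\<lambda>z. z) (\<lambda>\<nu>. \<nu>) (\<lambda>_. 0)"
  by (rule conj_monomials.intro) (simp_all add: pure_mon_def bounded_linear_ident)

lemma conj_monomials_mixed: "conj_monomials mixed_expo mixed_mon cnj fst snd"
  by (rule conj_monomials.intro) (simp_all add: mixed_mon_def mixed_expo_def bounded_linear_cnj)

theorem theorem1p1:
  assumes "CARD('k::finite) \<le> CARD('n::finite)"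
  shows
    "(\<forall>(F :: 'k \<Rightarrow> (nat ^ 'n) \<Rightarrow>\<^sub>0 real) C.
       (\<forall>j. \<not> pure.ev (F j) constant_on UNIV) \<and>
       pure.depends_on_all_variables F \<and>
       pure.pmap F 0 = 0 \<and>
       pure.dual_subdivision F C \<and>
       pure.nondegenerate_at_infinity F C
       \<longrightarrow> K_infinity (pure.pmap F) \<subseteq> pure.N_set F C \<union> pure.A_set F C) \<and>
     (\<forall>(F :: 'k \<Rightarrow> (nat ^ 'n) \<Rightarrow>\<^sub>0 complex) C.
       (\<forall>j. \<not> pure.ev (F j) constant_on UNIV) \<and>
       pure.depends_on_all_variables F \<and>
       pure.pmap F 0 = 0 \<and>
       pure.dual_subdivision F C \<and>
       pure.nondegenerate_at_infinity F C
       \<longrightarrow> K_infinity (pure.pmap F) \<subseteq> pure.N_set F C \<union> pure.A_set F C) \<and>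
     (\<forall>(F :: 'k \<Rightarrow> ((nat ^ 'n) \<times> (nat ^ 'n)) \<Rightarrow>\<^sub>0 complex) C.
       (\<forall>j. \<not> mixed.ev (F j) constant_on UNIV) \<and>
       mixed.depends_on_all_variables F \<and>
       mixed.pmap F 0 = 0 \<and>
       mixed.dual_subdivision F C \<and>
       mixed.nondegenerate_at_infinity F C
       \<longrightarrow> K_infinity (mixed.pmap F) \<subseteq> mixed.N_set F C \<union> mixed.A_set F C)"
  \<comment> \<open>Ordinary polynomials enter twice, over the reals and over the complex
    numbers.\<close>
  using conj_monomials.K_infinity_subset_N_set_A_set[OF conj_monomials_pure]
    conj_monomials.K_infinity_subset_N_set_A_set[OF conj_monomials_pure]
    conj_monomials.K_infinity_subset_N_set_A_set[OF conj_monomials_mixed]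
  by blast

end
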